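(* There exist absolute constants $C,c>0$ such that the following holds. Let $n\ge1$, $\epsilon\in(0,1]$, and let $f:\{0,1\}^n\to\{-1,1\}$ satisfy $\|f\|_{U_3}\ge\epsilon$. Then there exists a quadratic polynomial function $g$ such that the distance between $f$ and $g$ is at most $\frac12-\epsilon'$, where $\epsilon'\ge c\exp\{-(1/\epsilon)^C\}$.
   Context: $\{0,1\}^n$ is identified with $\mathbb F_2^n$. For $f:\{0,1\}^n\to\mathbb R$ and $d\ge1$, $\|f\|_{U_d}=\big[\mathbb E_{x,y_1,\dots,y_d}\prod_{S\subseteq[d]} f(x+\sum_{i\in S}y_i)\big]^{1/2^d}$ with $x,y_i$ independent uniform. A quadratic polynomial function is a function $g:\{0,1\}^n\to\{-1,1\}$ of the form $g(x)=(-1)^{P(x)}$ where $P$ is an $n$-variate polynomial over $\mathbb F_2$ of degree at most $2$. The distance between two functions $\{0,1\}^n\to\{-1,1\}$ is the fraction of points of $\{0,1\}^n$ at which they differ. *)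

theory Defs
  imports Complex_Main "HOL-Library.FuncSet"
begin

definition cube :: "nat \<Rightarrow> (nat \<Rightarrow> bool) set" where
  "cube n = {x. \<forall>i\<ge>n. \<not> x i}"

definition vadd :: "(nat \<Rightarrow> bool) \<Rightarrow> (nat \<Rightarrow> bool) \<Rightarrow> (nat \<Rightarrow> bool)" where
  "vadd x y = (\<lambda>j. x j \<noteq> y j)"

definition vsum :: "nat set \<Rightarrow> (nat \<Rightarrow> nat \<Rightarrow> bool) \<Rightarrow> (nat \<Rightarrow> bool)" where
  "vsum S ys = (\<lambda>j. odd (card {i\<in>S. ys i j}))"

definition gowers_norm :: "nat \<Rightarrow> nat \<Rightarrow> ((nat \<Rightarrow> bool) \<Rightarrow> real) \<Rightarrow> real" where
  "gowers_norm n d f =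
     root (2 ^ d)
       ((\<Sum>x\<in>cube n. \<Sum>ys\<in>PiE {..<d} (\<lambda>_. cube n).
           \<Prod>S\<in>Pow {..<d}. f (vadd x (vsum S ys))) / (2 ^ n) ^ (d + 1))"

text \<open>Quadratic polynomial functions: g = (-1)^P with P a polynomial over F_2 of degree at most 2,
  i.e. P(x) = c + sum_i b_i x_i + sum_{i,j} a_ij x_i x_j (mod 2).\<close>
definition quad_poly_fun :: "nat \<Rightarrow> ((nat \<Rightarrow> bool) \<Rightarrow> real) \<Rightarrow> bool" where
  "quad_poly_fun n g \<longleftrightarrow> (\<exists>(c0::bool) (b::nat \<Rightarrow> bool) (a::nat \<Rightarrow> nat \<Rightarrow> bool).
     \<forall>x\<in>cube n. g x = (-1) ^ (of_bool c0 + (\<Sum>i<n. of_bool (b i \<and> x i))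
                         + (\<Sum>i<n. \<Sum>j<n. of_bool (a i j \<and> x i \<and> x j)) :: nat))"

definition cube_dist :: "nat \<Rightarrow> ((nat \<Rightarrow> bool) \<Rightarrow> real) \<Rightarrow> ((nat \<Rightarrow> bool) \<Rightarrow> real) \<Rightarrow> real" where
  "cube_dist n f g = real (card {x\<in>cube n. f x \<noteq> g x}) / 2 ^ n"

end

theory Submission
  imports Defs "HOL-Library.Z2" "HOL-Library.Function_Algebras" "HOL-Analysis.Convex"
begin

text \<open>Write V for the cube, N = 2^n, and F(y, a) for the squared Fourier coefficient at a of the
  derivative x -> f(x) f(x + y). Then F sums to N, the eighth power of the U_3 norm is the sum of
  F^2 divided by N, and F is its own symplectic Fourier transform up to the factor N. Self-duality turns
  the sum of F(p) F(r) F(p + r) into N times the sum of F^3, which is large, so the large spectrum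
  of F has many additive triples. By Balog--Szemeredi--Gowers, Petridis' form of Pluennecke's
  inequality and Ruzsa covering, a good part of F lives on a subgroup of V x V of size comparable to N
  (this is where the exponential loss occurs), hence on a graph y -> M y + w with M linear.

  Let B(y, h) be the inner product of M y and h. Cauchy--Schwarz shows that B is symmetric up to small
  codimension, so B(u, u) = 0 on a large subgroup U. With a projection P onto U, the form
  B(P x, P y) is alternating, hence the polarisation of a quadratic form, and removing this quadratic
  phase leaves a sum that a single Fourier coefficient controls. The indicator of U is the average
  over v of the linear phases in x + P x, which transfers the correlation from U to all of V.\<close>

section \<open>Sumsets in groups of exponent two\<close>

text \<open>The self-duality of F rests on one symmetry: a box correlation does not change when its
  two directions are exchanged. Up to the covering step every loss is polynomial in the norm. There
  Ruzsa covering produces up to K^4 generators, whose span costs a factor 2^(K^4), with K of order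
  u^(-36) and u = epsilon^8. So the exponent is 8 * 36 * 4 = 1152, and one further unit absorbs the
  constants.

  The subgroup is essentially a graph because F sums to 1 over each fibre {y} x V: a subgroup with
  about N points and mass about N has a projection of size about N, hence few points above each y.

  Characteristic two is an obstacle. Moreover B is good only on U while the final polynomial must
  live on all of V. The projection P serves both ends: it lets sums over U be written as sums over
  V, where Fourier analysis is at hand, and it extends forms from U to V.\<close>

lemma card_translate_set:
  fixes X :: "'a::cancel_ab_semigroup_add set"
  shows "card (X + {c}) = card X"
proof -
  have "X + {c} = (\<lambda>x. x + c) ` X" by (auto simp: set_plus_def)
  moreover have "inj_on (\<lambda>x. x + c) X" by (auto simp: inj_on_def)
  ultimately show ?thesis by (simp add: card_image)
qed

lemma card_set_plus_ge:
  fixes X Y :: "'a::cancel_ab_semigroup_add set"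
  assumes "finite X" "finite Y" "X \<noteq> {}"
  shows "card Y \<le> card (X + Y)"
proof -
  obtain x where "x \<in> X" using assms by auto
  then have "Y + {x} \<subseteq> X + Y"
    by (auto simp: set_plus_def) (metis add.commute)
  then show ?thesis
    using card_mono[OF finite_set_plus[OF assms(1,2)]] card_translate_set[of Y x] by metis
qed

text \<open>\<open>min\<close> says that \<open>X\<close> minimises the ratio |Y + B| / |Y| among
  its subsets, cross-multiplied so that the empty set needs no exception. When \<open>c\<close>
  joins \<open>C\<close>, let \<open>Y\<close> be the part of \<open>X\<close> whose translate by
  \<open>c\<close> is already in \<open>X + C\<close>. Then \<open>X + C\<close> gains exactly |X| -
  |Y| points, while \<open>X + B + C\<close> gains at most |X + B| - |Y + B|, since
  \<open>Y + B + {c}\<close> was already there. Minimality at \<open>Y\<close> compares the two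
  gains.\<close>

lemma Petridis:
  fixes X B C :: "'a::ab_group_add set"
  assumes fin: "finite X" "finite B"
    and min: "\<And>Y. Y \<subseteq> X \<Longrightarrow> card (X + B) * card Y \<le> card (Y + B) * card X"
    and "finite C"
  shows "card (X + B + C) * card X \<le> card (X + B) * card (X + C)"
  using \<open>finite C\<close>
proof (induction C rule: finite_induct)
  case empty
  show ?case by simp
next
  case (insert c C)
  define Y where "Y = {x \<in> X. x + c \<in> X + C}"
  have YX: "Y \<subseteq> X" by (auto simp: Y_def)
  have finY: "finite Y" using YX fin finite_subset by blast
  have ins: "Z + insert c C = (Z + C) \<union> (Z + {c})" for Z :: "'a set"
    by (auto simp: set_plus_def)
  have 1: "X + insert c C = (X + C) \<union> ((X - Y) + {c})"
    unfolding ins by (auto simp: set_plus_def Y_def)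
  have dj: "(X + C) \<inter> ((X - Y) + {c}) = {}"
    by (auto simp: set_plus_def Y_def) (metis add.commute)+
  have c1: "card (X + insert c C) = card (X + C) + (card X - card Y)"
    unfolding 1 using dj fin insert finY YX
    by (subst card_Un_disjoint) (auto simp: card_translate_set card_Diff_subset intro!: finite_set_plus)
  have sub: "Y + B + {c} \<subseteq> X + B + C"
  proof -
    have "Y + {c} \<subseteq> X + C" by (auto simp: Y_def set_plus_def)
    then have "Y + {c} + B \<subseteq> X + C + B" by (rule set_plus_mono2) simp
    then show ?thesis by (simp add: ac_simps)
  qed
  have 2: "X + B + insert c C = (X + B + C) \<union> ((X + B + {c}) - (Y + B + {c}))"
    unfolding ins using sub by auto
  have fYB: "finite (Y + B + {c})" using finY fin by (intro finite_set_plus) auto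
  have YBX: "Y + B \<subseteq> X + B" using YX by (intro set_plus_mono2) auto
  have "card (X + B + insert c C) \<le> card (X + B + C) + card ((X + B + {c}) - (Y + B + {c}))"
    unfolding 2 by (rule card_Un_le)
  also have "card ((X + B + {c}) - (Y + B + {c})) = card (X + B) - card (Y + B)"
    by (subst card_Diff_subset[OF fYB set_plus_mono2[OF YBX subset_refl]]) (simp add: card_translate_set)
  finally have c2: "card (X + B + insert c C) \<le> card (X + B + C) + (card (X + B) - card (Y + B))" .
  have yx: "card Y \<le> card X" using YX fin card_mono by blast
  have ybx: "card (Y + B) \<le> card (X + B)" using YBX fin by (intro card_mono finite_set_plus) auto
  have "card (X + B + insert c C) * card X
      \<le> card (X + B + C) * card X + (card (X + B) * card X - card (Y + B) * card X)"
    using mult_right_mono[OF c2, of "card X"] by (simp add: algebra_simps diff_mult_distrib)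
  also have "\<dots> \<le> card (X + B) * card (X + C) + (card (X + B) * card X - card (X + B) * card Y)"
    using insert.IH min[OF YX] by (intro add_mono diff_le_mono2) auto
  also have "\<dots> = card (X + B) * card (X + insert c C)"
    by (simp add: c1 algebra_simps diff_mult_distrib2)
  finally show ?case .
qed

text \<open>For a subset \<open>X\<close> of \<open>A\<close> with the least ratio |X + A| / |X|,
  \<open>Petridis\<close> with \<open>B = A\<close> shows that each further summand \<open>A\<close>
  costs a factor \<open>K\<close>, starting from |X + A| \<le> K |X|. The translate by a point of
  \<open>X\<close> then bounds the fourfold sumset itself.\<close>

lemma fourfold_sumset_bound:
  fixes A :: "'a::ab_group_add set" and K :: real
  assumes fin: "finite A" and ne: "A \<noteq> {}" and K: "real (card (A + A)) \<le> K * card A"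
  shows "real (card (A + A + A + A)) \<le> K ^ 4 * card A"
proof -
  define r where "r = (\<lambda>Y::'a set. real (card (Y + A)) / card Y)"
  \<comment> \<open>The empty set has to be excluded: \<open>r {}\<close> is 0 / 0 = 0 and would be
    the minimiser.\<close>
  obtain X where X: "X \<subseteq> A" "X \<noteq> {}" and Xmin: "\<And>Y. Y \<subseteq> A \<Longrightarrow> Y \<noteq> {} \<Longrightarrow> r X \<le> r Y"
  proof -
    have "finite (r ` (Pow A - {{}}))" "r ` (Pow A - {{}}) \<noteq> {}" using fin ne by auto
    then have "Min (r ` (Pow A - {{}})) \<in> r ` (Pow A - {{}})" by (rule Min_in)
    then obtain X where X: "X \<in> Pow A - {{}}" "Min (r ` (Pow A - {{}})) = r X" by blast
    have "r X \<le> r Y" if "Y \<in> Pow A - {{}}" for Y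
      unfolding X(2)[symmetric] using that fin by (intro Min_le) auto
    with X show ?thesis by (intro that[of X]) auto
  qed
  have finX: "finite X" using X fin finite_subset by blast
  have cX: "card X > 0" using finX X by (simp add: card_gt_0_iff)
  have cA: "card A > 0" using fin ne by (simp add: card_gt_0_iff)
  have min: "card (X + A) * card Y \<le> card (Y + A) * card X" if "Y \<subseteq> X" for Y
  proof (cases "Y = {}")
    case False
    have "card Y > 0" using that False finX finite_subset by (auto simp: card_gt_0_iff)
    moreover have "r X \<le> r Y" using that False X by (intro Xmin) auto
    ultimately have "real (card (X + A)) * card Y \<le> real (card (Y + A)) * card X"
      using cX by (simp add: r_def field_simps)
    then show ?thesis by (metis of_nat_le_iff of_nat_mult)
  qed simp
  have "r X \<le> r A" by (rule Xmin) (use ne in auto)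
  also have "r A \<le> K" using K cA by (simp add: r_def field_simps)
  finally have rK: "real (card (X + A)) \<le> K * card X" using cX by (simp add: r_def field_simps)
  have K0: "K \<ge> 0" using rK cX by (smt (verit) of_nat_0_le_iff of_nat_0_less_iff mult_neg_pos)
  have step: "real (card (X + A + C)) \<le> K * card (X + C)" if "finite C" for C
  proof -
    have "real (card (X + A + C)) * card X \<le> real (card (X + A)) * card (X + C)"
      using Petridis[OF finX fin min that] by (metis of_nat_le_iff of_nat_mult)
    also have "\<dots> \<le> K * card X * card (X + C)" using rK by (intro mult_right_mono) auto
    finally show ?thesis using cX by (simp add: mult.commute mult.left_commute)
  qed
  have f2: "finite (A + A)" and f3: "finite (A + A + A)" and f4: "finite (A + A + A + A)"
    using fin by (auto intro!: finite_set_plus)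
  have s2: "real (card (X + A + A)) \<le> K * (K * card X)"
    using step[OF fin] mult_left_mono[OF rK K0] by linarith
  have s3: "real (card (X + A + (A + A))) \<le> K * (K * (K * card X))"
    using step[OF f2] mult_left_mono[OF s2 K0] by (simp add: add.assoc)
  have s4: "real (card (X + A + (A + A + A))) \<le> K * (K * (K * (K * card X)))"
    using step[OF f3] mult_left_mono[OF s3 K0] by (simp add: add.assoc)
  have "card (A + A + A + A) \<le> card (X + (A + A + A + A))"
    by (rule card_set_plus_ge[OF finX f4 X(2)])
  then have "real (card (A + A + A + A)) \<le> real (card (X + A + (A + A + A)))"
    by (simp add: add.assoc)
  also have "\<dots> \<le> K ^ 4 * card X" using s4 by (simp add: power4_eq_xxxx mult.assoc)
  also have "\<dots> \<le> K ^ 4 * card A" using card_mono[OF fin X(1)] by (intro mult_left_mono) auto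
  finally show ?thesis .
qed

text \<open>Closure under negation is omitted: the notion is used only where x + x = 0.\<close>

definition subgroup2 :: "'a::ab_group_add set \<Rightarrow> bool" where
  "subgroup2 H \<longleftrightarrow> 0 \<in> H \<and> (\<forall>x\<in>H. \<forall>y\<in>H. x + y \<in> H)"

text \<open>A new generator \<open>x\<close> turns \<open>L\<close> into the union of
  \<open>L\<close> and \<open>x + L\<close>, which is closed because x + x = 0 and at most doubles
  the size. Leastness is recorded because the ambient type is infinite: it later confines the
  subgroup to the finite cube.\<close>

lemma span2_finite:
  fixes X :: "'a::ab_group_add set"
  assumes tor: "\<And>x::'a. x + x = 0" and "finite X"
  shows "\<exists>L. subgroup2 L \<and> X \<subseteq> L \<and> finite L \<and> card L \<le> 2 ^ card X \<and>
    (\<forall>G. subgroup2 G \<longrightarrow> X \<subseteq> G \<longrightarrow> L \<subseteq> G)"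
  using \<open>finite X\<close>
proof (induction X rule: finite_induct)
  case empty
  show ?case by (intro exI[of _ "{0}"]) (auto simp: subgroup2_def)
next
  case (insert x X)
  then obtain L where L: "subgroup2 L" "X \<subseteq> L" "finite L" "card L \<le> 2 ^ card X"
    and Lmin: "\<And>G. subgroup2 G \<Longrightarrow> X \<subseteq> G \<Longrightarrow> L \<subseteq> G" by blast
  let ?L = "L \<union> (\<lambda>y. x + y) ` L"
  have canc: "x + (x + y) = y" for y
    using tor[of x] by (metis add.assoc add_0)
  have "subgroup2 ?L" unfolding subgroup2_def
  proof (intro conjI ballI)
    show "0 \<in> ?L" using L by (auto simp: subgroup2_def)
    fix u v assume "u \<in> ?L" "v \<in> ?L"
    then consider "u \<in> L" "v \<in> L" | z where "v \<in> L" "z \<in> L" "u = x + z"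
      | z where "u \<in> L" "z \<in> L" "v = x + z"
      | z z' where "z \<in> L" "z' \<in> L" "u = x + z" "v = x + z'" by blast
    then show "u + v \<in> ?L"
      using L(1) by cases (auto simp: subgroup2_def add.assoc add.left_commute canc)
  qed
  moreover have "insert x X \<subseteq> ?L"
    using L by (auto simp: subgroup2_def image_iff intro!: bexI[of _ 0])
  moreover have "card ?L \<le> 2 ^ card (insert x X)"
  proof -
    have "card ?L \<le> card L + card ((\<lambda>y. x + y) ` L)" by (rule card_Un_le)
    also have "\<dots> \<le> card L + card L" using card_image_le[OF L(3)] by simp
    finally show ?thesis using L insert by simp
  qed
  moreover have "?L \<subseteq> G" if "subgroup2 G" "insert x X \<subseteq> G" for G
    using that Lmin[of G] by (auto simp: subgroup2_def)
  ultimately show ?case using L(3) by (intro exI[of _ ?L]) auto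
qed

text \<open>Ruzsa covering: take a largest \<open>X\<close> inside \<open>A + A + A\<close> with
  pairwise disjoint translates \<open>x + A\<close>. These lie in the fourfold sumset, so |X| \<le>
  K^4; maximality makes every other translate meet one of them, so \<open>X + (A + A)\<close> covers
  \<open>A + A + A\<close>. With \<open>L\<close> the span of \<open>X\<close>, the set
  \<open>L + (A + A)\<close> is already a subgroup.\<close>

lemma small_doubling_subgroup:
  fixes A :: "'a::ab_group_add set" and K :: real
  assumes tor: "\<And>x::'a. x + x = 0"
    and fin: "finite A" and ne: "A \<noteq> {}" and K: "real (card (A + A)) \<le> K * card A"
  shows "\<exists>H. subgroup2 H \<and> A \<subseteq> H \<and> finite H \<and> real (card H) \<le> 2 powr (K ^ 4) * K * card A \<and>
    (\<forall>G. subgroup2 G \<longrightarrow> A \<subseteq> G \<longrightarrow> H \<subseteq> G)"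
proof -
  have cA: "card A > 0" using fin ne by (simp add: card_gt_0_iff)
  define P where "P = (\<lambda>X. X \<subseteq> A + A + A \<and> (\<forall>x\<in>X. \<forall>y\<in>X. x \<noteq> y \<longrightarrow> ({x} + A) \<inter> ({y} + A) = {}))"
  have f3: "finite (A + A + A)" using fin by (intro finite_set_plus)
  have Pf: "finite X" if "P X" for X using that f3 finite_subset by (auto simp: P_def)
  have "P {}" by (auto simp: P_def)
  then obtain X where X: "P X" and Xmax: "\<And>Y. P Y \<Longrightarrow> card Y \<le> card X"
    using ex_has_greatest_nat[of P "{}" card "Suc (card (A + A + A))"]
      card_mono[OF f3] by (metis P_def le_imp_less_Suc)
  have finX: "finite X" by (rule Pf[OF X])
  have cov: "A + A + A \<subseteq> X + (A + A)"
  proof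
    fix z assume z: "z \<in> A + A + A"
    show "z \<in> X + (A + A)"
    proof (cases "z \<in> X")
      case True
      \<comment> \<open>Exponent two puts 0 = a + a into \<open>A + A\<close>.\<close>
      obtain a where "a \<in> A" using ne by auto
      then have "z + (a + a) \<in> X + (A + A)" using True by (intro set_plus_intro)
      then show ?thesis by (simp add: tor)
    next
      case False
      have "\<not> P (insert z X)" using Xmax[of "insert z X"] False finX by auto
      then obtain y where y: "y \<in> X" "({z} + A) \<inter> ({y} + A) \<noteq> {}"
        using X z unfolding P_def by (metis Int_commute insert_iff insert_subset)
      then obtain a b where ab: "a \<in> A" "b \<in> A" "z + a = y + b" by (auto simp: set_plus_def)
      have "z = y + (b + a)" using ab(3) tor[of a]
        by (metis add.assoc add.right_neutral)
      then show ?thesis using y ab by (auto intro!: set_plus_intro)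
    qed
  qed
  have cX: "real (card X) \<le> K ^ 4"
  proof -
    have "card X * card A = (\<Sum>x\<in>X. card ({x} + A))"
      by (simp add: add.commute[of "{_}"] card_translate_set)
    also have "\<dots> = card (\<Union>x\<in>X. {x} + A)"
      using X finX fin by (subst card_UN_disjoint) (auto simp: P_def intro!: finite_set_plus)
    also have "\<dots> \<le> card (A + A + A + A)"
    proof (rule card_mono)
      show "finite (A + A + A + A)" using fin by (intro finite_set_plus)
      show "(\<Union>x\<in>X. {x} + A) \<subseteq> A + A + A + A"
        using X by (intro UN_least set_plus_mono2) (auto simp: P_def)
    qed
    finally have "real (card X) * card A \<le> real (card (A + A + A + A))"
      by (metis of_nat_le_iff of_nat_mult)
    also have "\<dots> \<le> K ^ 4 * card A" by (rule fourfold_sumset_bound[OF fin ne K])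
    finally show ?thesis using cA by simp
  qed
  obtain L where L: "subgroup2 L" "X \<subseteq> L" "finite L" "card L \<le> 2 ^ card X"
    and Lmin: "\<And>G. subgroup2 G \<Longrightarrow> X \<subseteq> G \<Longrightarrow> L \<subseteq> G" using span2_finite[OF tor finX] by blast
  have LL: "L + L \<subseteq> L" using L(1) by (auto simp: subgroup2_def set_plus_def)
  \<comment> \<open>Each use of the covering trades one summand \<open>A\<close> for an element of
    \<open>X\<close>, so two uses reduce four summands to two.\<close>
  have four: "A + A + (A + A) \<subseteq> L + (A + A)"
  proof -
    have "A + (A + A + A) \<subseteq> A + (X + (A + A))" by (intro set_plus_mono2 cov subset_refl)
    also have "\<dots> = X + (A + A + A)" by (simp add: ac_simps)
    also have "\<dots> \<subseteq> X + (X + (A + A))" by (intro set_plus_mono2 cov subset_refl)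
    also have "\<dots> = (X + X) + (A + A)" by (simp add: ac_simps)
    also have "\<dots> \<subseteq> (L + L) + (A + A)" using L by (intro set_plus_mono2) auto
    also have "\<dots> \<subseteq> L + (A + A)" by (intro set_plus_mono2 LL subset_refl)
    finally show ?thesis by (simp add: ac_simps)
  qed
  define H where "H = L + (A + A)"
  have H: "subgroup2 H" unfolding subgroup2_def
  proof (intro conjI ballI)
    obtain a where "a \<in> A" using ne by auto
    then have "0 + (a + a) \<in> H" unfolding H_def using L(1)
      by (intro set_plus_intro) (auto simp: subgroup2_def)
    then show "0 \<in> H" by (simp add: tor)
    fix x y assume "x \<in> H" "y \<in> H"
    then have "x + y \<in> H + H" by (rule set_plus_intro)
    also have "H + H = (L + L) + (A + A + (A + A))" by (simp add: H_def ac_simps)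
    also have "\<dots> \<subseteq> L + (L + (A + A))" by (rule set_plus_mono2[OF LL four])
    also have "\<dots> = (L + L) + (A + A)" by (simp add: ac_simps)
    also have "\<dots> \<subseteq> H" unfolding H_def by (rule set_plus_mono2[OF LL subset_refl])
    finally show "x + y \<in> H" .
  qed
  have XH: "X + (A + A) \<subseteq> H" unfolding H_def using L by (intro set_plus_mono2) auto
  have AH: "A \<subseteq> H"
  proof
    fix a assume "a \<in> A"
    then have "a + a + a \<in> A + A + A" by (intro set_plus_intro)
    then have "a + a + a \<in> H" using cov XH by blast
    then show "a \<in> H" by (simp add: tor)
  qed
  have "card H \<le> card L * card (A + A)"
  proof -
    have "H = (\<lambda>(x, y). x + y) ` (L \<times> (A + A))" unfolding H_def by (subst set_plus_image) simp
    then show ?thesis using L fin card_image_le[of "L \<times> (A + A)" "\<lambda>(x, y). x + y"]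
      by (simp add: card_cartesian_product finite_set_plus)
  qed
  then have "real (card H) \<le> real (card L) * card (A + A)" by (metis of_nat_le_iff of_nat_mult)
  also have "\<dots> \<le> 2 powr (K ^ 4) * (K * card A)"
  proof (rule mult_mono[OF _ K])
    have "real (card L) \<le> 2 ^ card X" using L(4) by (metis of_nat_le_iff of_nat_numeral of_nat_power)
    also have "\<dots> = 2 powr card X" by (simp add: powr_realpow)
    also have "\<dots> \<le> 2 powr (K ^ 4)" using cX by simp
    finally show "real (card L) \<le> 2 powr (K ^ 4)" .
  qed auto
  finally have "real (card H) \<le> 2 powr (K ^ 4) * K * card A" by simp
  moreover have "finite H" unfolding H_def using L fin by (intro finite_set_plus)
  moreover have "H \<subseteq> G" if G: "subgroup2 G" "A \<subseteq> G" for G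
  proof -
    have GG: "G + G \<subseteq> G" using G(1) by (auto simp: subgroup2_def set_plus_def)
    have "A + A \<subseteq> G" using set_plus_mono2[OF G(2) G(2)] GG by blast
    moreover from this have "A + A + A \<subseteq> G" using set_plus_mono2[OF _ G(2)] GG by blast
    then have "L \<subseteq> G" using X by (intro Lmin G) (auto simp: P_def)
    ultimately show ?thesis unfolding H_def using set_plus_mono2 GG by blast
  qed
  ultimately show ?thesis using H AH by blast
qed

section \<open>The Balog--Szemeredi--Gowers theorem in exponent two\<close>

lemma card_Collect_swap:
  fixes R :: "'a \<Rightarrow> 'b \<Rightarrow> bool"
  assumes "finite A" "finite B"
  shows "(\<Sum>x\<in>A. card {y\<in>B. R x y}) = (\<Sum>y\<in>B. card {x\<in>A. R x y})"
proof -
  have "(\<Sum>x\<in>A. card {y\<in>B. R x y}) = (\<Sum>x\<in>A. \<Sum>y\<in>B. of_bool (R x y))"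
    using assms by (simp add: sum.If_cases of_bool_def Int_def)
  also have "\<dots> = (\<Sum>y\<in>B. \<Sum>x\<in>A. of_bool (R x y))" by (rule sum.swap)
  also have "\<dots> = (\<Sum>y\<in>B. card {x\<in>A. R x y})"
    using assms by (simp add: sum.If_cases of_bool_def Int_def)
  finally show ?thesis .
qed

text \<open>Dependent random choice in the graph on A joining a and b when a + b lies in A: inside a suitable
  neighbourhood S, most pairs have many common neighbours, so any two points of A' are joined by
  many paths of length four, and the edges of such a path add up to the sum of its end points.\<close>

lemma Balog_Szemeredi_Gowers:
  fixes A :: "'a::ab_group_add set" and c :: real
  assumes tor: "\<And>x::'a. x + x = 0"
    and fin: "finite A" and ne: "A \<noteq> {}" and c: "c > 0"
    and many: "c * card A ^ 2 \<le> card {(a, b) \<in> A \<times> A. a + b \<in> A}"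
  shows "\<exists>A'\<subseteq>A. c * card A / 4 \<le> card A' \<and> c ^ 5 * card (A' + A') \<le> 1024 * card A"
proof -
  define m where "m = real (card A)"
  have m0: "m > 0" using fin ne by (simp add: m_def card_gt_0_iff)
  define nb where "nb = (\<lambda>v. {b\<in>A. v + b \<in> A})"
  have finnb: "finite (nb v)" for v using fin by (simp add: nb_def)
  \<comment> \<open>A good pair has many common neighbours. The factor 1/16 is tuned to the weight 8
    used for choosing \<open>v\<close>: then 8 times the mean number of bad pairs is at most half
    the lower bound for the mean square degree.\<close>
  define good where "good = (\<lambda>a a'. c ^ 2 / 16 * m \<le> card (nb a \<inter> nb a'))"
  define bad where "bad = (\<lambda>v. {p \<in> nb v \<times> nb v. \<not> good (fst p) (snd p)})"
  have finbad: "finite (bad v)" for v using finnb by (simp add: bad_def)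
  have deg: "(\<Sum>v\<in>A. real (card (nb v))) = card {(a, b) \<in> A \<times> A. a + b \<in> A}"
  proof -
    have "{(a, b) \<in> A \<times> A. a + b \<in> A} = Sigma A nb" by (auto simp: nb_def)
    then show ?thesis using fin finnb by simp
  qed
  have deg2: "c ^ 2 * m ^ 3 \<le> (\<Sum>v\<in>A. real (card (nb v)) ^ 2)"
  proof -
    have "(c * m ^ 2) ^ 2 \<le> (\<Sum>v\<in>A. real (card (nb v))) ^ 2"
      using many c unfolding deg m_def by (intro power_mono) auto
    also have "\<dots> \<le> m * (\<Sum>v\<in>A. real (card (nb v)) ^ 2)"
      using Cauchy_Schwarz_ineq_sum[of "\<lambda>_. 1" "\<lambda>v. real (card (nb v))" A] by (simp add: m_def)
    finally have "m * (c ^ 2 * m ^ 3) \<le> m * (\<Sum>v\<in>A. real (card (nb v)) ^ 2)"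
      by (simp add: power_mult_distrib eval_nat_numeral mult_ac)
    then show ?thesis using m0 by simp
  qed
  have badsum: "(\<Sum>v\<in>A. real (card (bad v))) \<le> c ^ 2 / 16 * m ^ 3"
  proof -
    let ?Q = "{p \<in> A \<times> A. \<not> good (fst p) (snd p)}"
    have finQ: "finite ?Q" using fin by simp
    have "(\<Sum>v\<in>A. card (bad v)) = (\<Sum>v\<in>A. card {p \<in> ?Q. fst p \<in> nb v \<and> snd p \<in> nb v})"
      by (intro sum.cong refl arg_cong[of _ _ card]) (auto simp: bad_def nb_def)
    also have "\<dots> = (\<Sum>p\<in>?Q. card {v \<in> A. fst p \<in> nb v \<and> snd p \<in> nb v})"
      by (rule card_Collect_swap[OF fin finQ])
    also have "\<dots> = (\<Sum>p\<in>?Q. card (nb (fst p) \<inter> nb (snd p)))"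
      by (intro sum.cong refl arg_cong[of _ _ card]) (auto simp: nb_def add.commute)
    finally have "(\<Sum>v\<in>A. real (card (bad v))) = (\<Sum>p\<in>?Q. real (card (nb (fst p) \<inter> nb (snd p))))"
      by (simp only: of_nat_sum[symmetric])
    also have "\<dots> \<le> (\<Sum>p\<in>?Q. c ^ 2 / 16 * m)" by (intro sum_mono) (auto simp: good_def)
    also have "\<dots> = card ?Q * (c ^ 2 / 16 * m)" by simp
    also have "\<dots> \<le> m ^ 2 * (c ^ 2 / 16 * m)"
    proof (rule mult_right_mono)
      have "card ?Q \<le> card (A \<times> A)" using fin by (intro card_mono) auto
      then have "card ?Q \<le> card A * card A" by (simp add: card_cartesian_product)
      then show "real (card ?Q) \<le> m ^ 2" unfolding m_def power2_eq_square
        by (metis of_nat_le_iff of_nat_mult)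
    qed (use m0 in auto)
    finally show ?thesis by (simp add: eval_nat_numeral mult_ac)
  qed
  \<comment> \<open>On average over \<open>v\<close>, the squared degree is at least c^2 m^2 and
    eight times the bad pairs cost at most c^2 m^2 / 2. One \<open>v\<close> therefore gives both a
    large neighbourhood and few bad pairs in it, since the difference is nonnegative.\<close>
  obtain v where v: "v \<in> A" "c ^ 2 / 2 * m ^ 2 \<le> real (card (nb v)) ^ 2 - 8 * card (bad v)"
  proof (rule ccontr)
    assume "\<not> thesis"
    then have "\<And>v. v \<in> A \<Longrightarrow> real (card (nb v)) ^ 2 - 8 * card (bad v) < c ^ 2 / 2 * m ^ 2"
      using that by force
    then have "(\<Sum>v\<in>A. real (card (nb v)) ^ 2 - 8 * card (bad v)) < (\<Sum>v\<in>A. c ^ 2 / 2 * m ^ 2)"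
      by (intro sum_strict_mono fin ne)
    also have "\<dots> = c ^ 2 / 2 * m ^ 3" by (simp add: m_def eval_nat_numeral)
    finally have "(\<Sum>v\<in>A. real (card (nb v)) ^ 2) - 8 * (\<Sum>v\<in>A. real (card (bad v))) < c ^ 2 / 2 * m ^ 3"
      by (simp add: sum_subtractf sum_distrib_left)
    with deg2 badsum show False by simp
  qed
  define S where "S = nb v"
  have finS: "finite S" and SA: "S \<subseteq> A" using fin by (auto simp: S_def nb_def)
  have S_large: "c * m / 2 \<le> card S"
  proof (rule power2_le_imp_le)
    have "c ^ 2 * m ^ 2 \<ge> 0" by simp
    then have "(c * m / 2) ^ 2 \<le> c ^ 2 / 2 * m ^ 2" by (simp add: power_mult_distrib power_divide)
    also have "\<dots> \<le> real (card S) ^ 2" using v by (simp add: S_def)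
    finally show "(c * m / 2) ^ 2 \<le> real (card S) ^ 2" .
  qed simp
  have S0: "card S > 0" using S_large c m0 by (smt (verit) divide_pos_pos mult_pos_pos of_nat_0_less_iff)
  define cobad where "cobad = (\<lambda>a. {a'\<in>S. \<not> good a a'})"
  \<comment> \<open>At most half of \<open>S\<close> is discarded, by counting bad pairs. A kept
    point is bad with at most a quarter of \<open>S\<close>, so any two kept points have a common
    set \<open>T\<close> of good partners filling at least half of \<open>S\<close>.\<close>
  define A' where "A' = {a\<in>S. 4 * card (cobad a) \<le> card S}"
  have A'S: "A' \<subseteq> S" by (auto simp: A'_def)
  have "card S * card (S - A') \<le> 4 * card (bad v)"
  proof -
    have "card S * card (S - A') = (\<Sum>a\<in>S - A'. card S)" by simp
    also have "\<dots> \<le> (\<Sum>a\<in>S - A'. 4 * card (cobad a))"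
      by (intro sum_mono) (auto simp: A'_def)
    also have "\<dots> \<le> (\<Sum>a\<in>S. 4 * card (cobad a))" using finS by (intro sum_mono2) auto
    also have "\<dots> = 4 * card (Sigma S cobad)"
      using finS by (simp add: cobad_def sum_distrib_left)
    also have "Sigma S cobad = bad v" by (auto simp: bad_def cobad_def S_def)
    finally show ?thesis .
  qed
  then have "real (card S) * card (S - A') \<le> 4 * real (card (bad v))"
    by (metis of_nat_le_iff of_nat_mult of_nat_numeral)
  also have "\<dots> \<le> real (card S) * (card S / 2)"
  proof -
    have "c ^ 2 / 2 * m ^ 2 \<ge> 0" by simp
    then have "8 * real (card (bad v)) \<le> real (card S) ^ 2" using v(2) unfolding S_def by linarith
    then show ?thesis by (simp add: power2_eq_square)
  qed
  finally have "real (card (S - A')) \<le> card S / 2" using S0 by simp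
  moreover have "card (S - A') = card S - card A'" "card A' \<le> card S"
    using finS A'S by (auto intro: card_Diff_subset finite_subset card_mono)
  ultimately have A'_half: "card S / 2 \<le> card A'" by simp
  \<comment> \<open>The middle vertex has |T| \<ge> c m / 4 choices and each of the other two inner
    vertices c^2 m / 16, whence 1024 = 4 * 16^2. For fixed ends a path is recovered from its edge
    sums, and the inner vertices cancel in their total.\<close>
  have paths: "c ^ 5 / 1024 * m ^ 3 \<le>
      card {(p, q, r, s) \<in> A \<times> A \<times> A \<times> A. p + q + r + s = a + a'}"
    if a: "a \<in> A'" "a' \<in> A'" for a a'
  proof -
    define T where "T = {x\<in>S. good a x \<and> good a' x}"
    have finT: "finite T" using finS by (simp add: T_def)
    have T: "card S / 2 \<le> card T"
    proof -
      have "S = T \<union> (cobad a \<union> cobad a')" by (auto simp: T_def cobad_def)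
      then have "card S \<le> card T + card (cobad a \<union> cobad a')" using card_Un_le by metis
      moreover have "card (cobad a \<union> cobad a') \<le> card (cobad a) + card (cobad a')"
        by (rule card_Un_le)
      moreover have "4 * card (cobad a) \<le> card S" "4 * card (cobad a') \<le> card S"
        using a by (auto simp: A'_def)
      ultimately have "card S \<le> 2 * card T" by linarith
      then show ?thesis by linarith
    qed
    define Z where "Z = (SIGMA x:T. (nb a \<inter> nb x) \<times> (nb a' \<inter> nb x))"
    have cZ: "real (card Z) = (\<Sum>x\<in>T. real (card (nb a \<inter> nb x)) * real (card (nb a' \<inter> nb x)))"
      using finT finnb by (simp add: Z_def card_cartesian_product)
    have "c ^ 5 / 1024 * m ^ 3 = c * m / 4 * (c ^ 2 / 16 * m) ^ 2"
      by (simp add: eval_nat_numeral)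
    also have "\<dots> \<le> card T * (c ^ 2 / 16 * m) ^ 2"
      using S_large T by (intro mult_right_mono) auto
    also have "\<dots> = (\<Sum>x\<in>T. (c ^ 2 / 16 * m) * (c ^ 2 / 16 * m))"
      by (simp add: power2_eq_square)
    also have "\<dots> \<le> real (card Z)" unfolding cZ
      using m0 by (intro sum_mono mult_mono) (auto simp: T_def good_def)
    also have "card Z \<le> card {(p, q, r, s) \<in> A \<times> A \<times> A \<times> A. p + q + r + s = a + a'}"
    proof (rule card_inj_on_le)
      let ?h = "\<lambda>(x, b, b'). (a + b, b + x, x + b', b' + a')"
      show "inj_on ?h Z" by (auto simp: inj_on_def)
      show "?h ` Z \<subseteq> {(p, q, r, s) \<in> A \<times> A \<times> A \<times> A. p + q + r + s = a + a'}"
      proof (rule image_subsetI)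
        fix z assume "z \<in> Z"
        then obtain x b b' where z: "z = (x, b, b')"
          and b: "b \<in> nb a" "b \<in> nb x" "b' \<in> nb a'" "b' \<in> nb x" by (auto simp: Z_def)
        have "a + b + (b + x) + (x + b') + (b' + a') = a + (b + b) + (x + x) + (b' + b') + a'"
          by (simp add: ac_simps)
        then have "a + b + (b + x) + (x + b') + (b' + a') = a + a'"
          unfolding tor by simp
        moreover have "a + b \<in> A \<and> b + x \<in> A \<and> x + b' \<in> A \<and> b' + a' \<in> A"
          using b by (auto simp: nb_def add.commute)
        ultimately show "?h z \<in> {(p, q, r, s) \<in> A \<times> A \<times> A \<times> A. p + q + r + s = a + a'}"
          unfolding z by (simp only: prod.case mem_Collect_eq mem_Sigma_iff)
      qed
      show "finite {(p, q, r, s) \<in> A \<times> A \<times> A \<times> A. p + q + r + s = a + a'}"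
        by (rule finite_subset[of _ "A \<times> A \<times> A \<times> A"]) (use fin in auto)
    qed
    finally show ?thesis by simp
  qed
  \<comment> \<open>Quadruples with different sums are different, so the sets of representations of
    the elements of \<open>A' + A'\<close> share the m^4 quadruples of \<open>A\<close>.\<close>
  have "real (card (A' + A')) * (c ^ 5 / 1024 * m ^ 3) \<le> m ^ 4"
  proof -
    let ?R = "\<lambda>z. {(p, q, r, s) \<in> A \<times> A \<times> A \<times> A. p + q + r + s = z}"
    have finR: "finite (?R z)" for z
      by (rule finite_subset[of _ "A \<times> A \<times> A \<times> A"]) (use fin in auto)
    have finA': "finite (A' + A')" using A'S finS finite_subset by (blast intro: finite_set_plus)
    have "real (card (A' + A')) * (c ^ 5 / 1024 * m ^ 3) = (\<Sum>z\<in>A' + A'. c ^ 5 / 1024 * m ^ 3)"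
      by simp
    also have "\<dots> \<le> (\<Sum>z\<in>A' + A'. real (card (?R z)))"
      using paths by (intro sum_mono) (auto elim!: set_plus_elim)
    also have "\<dots> = real (card (\<Union>z\<in>A' + A'. ?R z))"
      using finA' finR by (subst card_UN_disjoint) auto
    also have "card (\<Union>z\<in>A' + A'. ?R z) \<le> card (A \<times> A \<times> A \<times> A)"
      using fin by (intro card_mono) auto
    also have "real (card (A \<times> A \<times> A \<times> A)) = m ^ 4"
      by (simp add: card_cartesian_product m_def eval_nat_numeral)
    finally show ?thesis by simp
  qed
  then have "m ^ 3 * (c ^ 5 * card (A' + A')) \<le> m ^ 3 * (1024 * m)"
    by (simp add: field_simps eval_nat_numeral)
  then have "c ^ 5 * card (A' + A') \<le> 1024 * m" using m0 by simp
  moreover have "c * m / 4 \<le> card A'" using A'_half S_large by simp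
  ultimately show ?thesis using A'S SA by (intro exI[of _ A'] conjI) (auto simp: m_def)
qed

text \<open>\<open>K\<close> combines the two bounds of \<open>Balog_Szemeredi_Gowers\<close>: |B +
  B| \<le> 1024 |A| / c^5 and |A| \<le> 4 |B| / c. Only a proportion c / 4 of \<open>A\<close> is
  guaranteed to lie in \<open>H\<close>.\<close>

lemma many_sums_subgroup:
  fixes A :: "'a::ab_group_add set" and c K :: real
  assumes tor: "\<And>x::'a. x + x = 0"
    and fin: "finite A" and ne: "A \<noteq> {}" and c: "c > 0"
    and many: "c * card A ^ 2 \<le> card {(a, b) \<in> A \<times> A. a + b \<in> A}"
  defines "K \<equiv> 4096 / c ^ 6"
  shows "\<exists>H. subgroup2 H \<and> finite H \<and> real (card H) \<le> 2 powr (K ^ 4) * K * card A \<and>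
    c * card A / 4 \<le> card (A \<inter> H) \<and> (\<forall>G. subgroup2 G \<longrightarrow> A \<subseteq> G \<longrightarrow> H \<subseteq> G)"
proof -
  obtain B where B: "B \<subseteq> A" "c * card A / 4 \<le> card B" "c ^ 5 * card (B + B) \<le> 1024 * card A"
    using Balog_Szemeredi_Gowers[OF tor fin ne c many] by blast
  have cA: "card A > 0" using fin ne by (simp add: card_gt_0_iff)
  have finB: "finite B" using B fin finite_subset by blast
  have "real (card B) > 0" using B(2) c cA by (smt (verit) divide_pos_pos mult_pos_pos of_nat_0_less_iff)
  then have neB: "B \<noteq> {}" by auto
  have K0: "K \<ge> 0" using c by (simp add: K_def)
  have dbl: "real (card (B + B)) \<le> K * card B"
  proof -
    have "c ^ 6 * card (B + B) = c * (c ^ 5 * card (B + B))" by (simp add: eval_nat_numeral)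
    also have "\<dots> \<le> c * (1024 * card A)" using B(3) c by (intro mult_left_mono) auto
    also have "\<dots> \<le> 4096 * card B" using B(2) by simp
    finally show ?thesis using c by (simp add: K_def field_simps)
  qed
  obtain H where H: "subgroup2 H" "B \<subseteq> H" "finite H" "real (card H) \<le> 2 powr (K ^ 4) * K * card B"
    and Hmin: "\<And>G. subgroup2 G \<Longrightarrow> B \<subseteq> G \<Longrightarrow> H \<subseteq> G"
    using small_doubling_subgroup[OF tor finB neB dbl] by blast
  have "2 powr (K ^ 4) * K * card B \<le> 2 powr (K ^ 4) * K * card A"
    using card_mono[OF fin B(1)] K0 by (intro mult_left_mono) auto
  then have "real (card H) \<le> 2 powr (K ^ 4) * K * card A" using H(4) by linarith
  moreover have "card B \<le> card (A \<inter> H)" using B H fin by (intro card_mono) auto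
  then have "c * card A / 4 \<le> card (A \<inter> H)" using B(2) by linarith
  moreover have "H \<subseteq> G" if "subgroup2 G" "A \<subseteq> G" for G using that B(1) by (intro Hmin) auto
  ultimately show ?thesis using H(1,3) by meson
qed

section \<open>The spectrum of the derivatives\<close>

lemma bit_double [simp]: "a + a = 0" "a + (a + b) = b" for a b :: bit
  by (cases a; cases b; simp)+

declare add_bit_eq_xor [simp del] mult_bit_eq_and [simp del]

text \<open>The copy of \<open>cube\<close> over the field \<open>bit\<close>: addition is pointwise
  addition of functions, so group laws, finite sums and linear algebra are available.\<close>

definition bcube :: "nat \<Rightarrow> (nat \<Rightarrow> bit) set" where
  "bcube n = {x. \<forall>i\<ge>n. x i = 0}"

definition dot :: "nat \<Rightarrow> (nat \<Rightarrow> bit) \<Rightarrow> (nat \<Rightarrow> bit) \<Rightarrow> bit" where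
  "dot n a x = (\<Sum>i<n. a i * x i)"

definition chi :: "bit \<Rightarrow> real" where
  "chi b = (if b = 0 then 1 else - 1)"

lemma chi_0 [simp]: "chi 0 = 1" and chi_1 [simp]: "chi 1 = - 1"
  by (simp_all add: chi_def)

lemma chi_add: "chi (a + b) = chi a * chi b"
  by (cases a; cases b) (simp_all add: chi_def)

lemma chi_square [simp]: "chi a * chi a = 1" "chi a ^ 2 = 1"
  by (simp_all add: chi_def)

lemma abs_chi [simp]: "\<bar>chi a\<bar> = 1"
  by (simp add: chi_def)

lemma bvec_add_self [simp]: "x + x = 0" for x :: "nat \<Rightarrow> bit"
  by (rule ext) simp

lemma bvec_add_self_left [simp]: "x + (x + y) = y" for x :: "nat \<Rightarrow> bit"
  by (simp add: add.assoc[symmetric])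

lemma bvec_add_eq_0 [simp]: "x + y = 0 \<longleftrightarrow> x = y" for x y :: "nat \<Rightarrow> bit"
  by (metis bvec_add_self add_left_cancel)

lemma bvec_pair_add_self: "p + p = 0" for p :: "(nat \<Rightarrow> bit) \<times> (nat \<Rightarrow> bit)"
  by (simp add: plus_prod_def zero_prod_def)

lemma bcube_zero [simp]: "0 \<in> bcube n"
  by (simp add: bcube_def)

lemma bcube_nonempty [simp]: "bcube n \<noteq> {}"
  using bcube_zero by blast

lemma bcube_add [simp]: "x \<in> bcube n \<Longrightarrow> y \<in> bcube n \<Longrightarrow> x + y \<in> bcube n"
  by (simp add: bcube_def)

lemma bcube_card: "finite (bcube n)" "card (bcube n) = 2 ^ n"
proof -
  have b: "bij_betw (\<lambda>S i. of_bool (i \<in> S)) (Pow {..<n}) (bcube n)"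
  proof (rule bij_betw_byWitness[where f' = "\<lambda>x. {i. x i = 1}"])
    show "\<forall>x\<in>bcube n. (\<lambda>i. of_bool (i \<in> {i. x i = 1})) = x"
      by (auto simp: fun_eq_iff of_bool_def)
    show "(\<lambda>x. {i. x i = 1}) ` bcube n \<subseteq> Pow {..<n}"
      by (auto simp: bcube_def) (metis bit_not_one_iff leI)
  qed (auto simp: bcube_def)
  show "finite (bcube n)" using bij_betw_finite[OF b] by simp
  show "card (bcube n) = 2 ^ n" using bij_betw_same_card[OF b] by (simp add: card_Pow)
qed

declare bcube_card(1) [simp]

lemma real_card_bcube [simp]: "real (card (bcube n)) = 2 ^ n"
  by (simp add: bcube_card)

lemma sum_translate:
  assumes "t \<in> bcube n"
  shows "(\<Sum>x\<in>bcube n. g (x + t)) = (\<Sum>x\<in>bcube n. g x)"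
  by (rule sum.reindex_bij_witness[of _ "\<lambda>x. x + t" "\<lambda>x. x + t"]) (use assms in \<open>auto simp: add.assoc\<close>)

lemma sum_translate':
  assumes "t \<in> bcube n"
  shows "(\<Sum>x\<in>bcube n. g (t + x)) = (\<Sum>x\<in>bcube n. g x)"
  using sum_translate[OF assms, of g] by (simp add: add.commute)

text \<open>If \<open>L t = 1\<close> for some \<open>t\<close>, translation by \<open>t\<close>
  changes the sign of the sum, which must then vanish.\<close>

lemma sum_chi_additive:
  assumes L: "\<And>x y. x \<in> bcube n \<Longrightarrow> y \<in> bcube n \<Longrightarrow> L (x + y) = L x + L y"
  shows "(\<Sum>x\<in>bcube n. chi (L x)) = (if \<forall>x\<in>bcube n. L x = 0 then 2 ^ n else 0)"
proof (cases "\<forall>x\<in>bcube n. L x = 0")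
  case False
  then obtain t where t: "t \<in> bcube n" "L t = 1" by auto
  have "(\<Sum>x\<in>bcube n. chi (L x)) = (\<Sum>x\<in>bcube n. chi (L (x + t)))"
    by (rule sum_translate[OF t(1), symmetric])
  also have "\<dots> = - (\<Sum>x\<in>bcube n. chi (L x))"
    using t by (simp add: L chi_add sum_negf)
  finally show ?thesis using False by auto
qed simp

lemma dot_commute: "dot n a x = dot n x a"
  by (simp add: dot_def mult.commute)

lemma dot_add_left: "dot n (a + b) x = dot n a x + dot n b x"
  by (simp add: dot_def distrib_right sum.distrib)

lemma dot_add_right: "dot n a (x + y) = dot n a x + dot n a y"
  by (simp add: dot_def distrib_left sum.distrib)

lemma dot_zero [simp]: "dot n 0 x = 0" "dot n a 0 = 0"
  by (simp_all add: dot_def)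

definition unit_bvec :: "nat \<Rightarrow> nat \<Rightarrow> bit" where
  "unit_bvec i = (\<lambda>j. of_bool (j = i))"

lemma unit_bvec_in [simp]: "i < n \<Longrightarrow> unit_bvec i \<in> bcube n"
  by (auto simp: unit_bvec_def bcube_def)

lemma dot_unit: "i < n \<Longrightarrow> dot n a (unit_bvec i) = a i"
  by (simp add: dot_def unit_bvec_def of_bool_def if_distrib[of "\<lambda>b. a _ * b"] cong: if_cong)

lemma dot_nondegenerate:
  assumes "a \<in> bcube n" "\<And>x. x \<in> bcube n \<Longrightarrow> dot n a x = 0"
  shows "a = 0"
proof
  fix i
  show "a i = 0 i"
  proof (cases "i < n")
    case True
    then show ?thesis using assms(2)[of "unit_bvec i"] by (simp add: dot_unit)
  next
    case False
    then show ?thesis using assms(1) by (simp add: bcube_def)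
  qed
qed

lemma sum_chi_dot:
  assumes "a \<in> bcube n"
  shows "(\<Sum>x\<in>bcube n. chi (dot n a x)) = (if a = 0 then 2 ^ n else 0)"
proof -
  have "(\<forall>x\<in>bcube n. dot n a x = 0) \<longleftrightarrow> a = 0" using dot_nondegenerate[OF assms] by auto
  then show ?thesis by (simp add: sum_chi_additive dot_add_right)
qed

definition ft :: "nat \<Rightarrow> ((nat \<Rightarrow> bit) \<Rightarrow> real) \<Rightarrow> (nat \<Rightarrow> bit) \<Rightarrow> real" where
  "ft n g a = (\<Sum>x\<in>bcube n. g x * chi (dot n a x))"

lemma ft_inversion:
  assumes z: "z \<in> bcube n"
  shows "(\<Sum>a\<in>bcube n. ft n g a * chi (dot n a z)) = 2 ^ n * g z"
proof -
  have "(\<Sum>a\<in>bcube n. ft n g a * chi (dot n a z))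
      = (\<Sum>a\<in>bcube n. \<Sum>x\<in>bcube n. g x * chi (dot n (x + z) a))"
    unfolding ft_def sum_distrib_right
    by (intro sum.cong refl) (simp add: dot_commute[of n "_ + z"] dot_add_right chi_add mult.assoc)
  also have "\<dots> = (\<Sum>x\<in>bcube n. \<Sum>a\<in>bcube n. g x * chi (dot n (x + z) a))" by (rule sum.swap)
  also have "\<dots> = (\<Sum>x\<in>bcube n. g x * (if x = z then 2 ^ n else 0))"
    using z by (simp add: sum_distrib_left[symmetric] sum_chi_dot)
  also have "\<dots> = 2 ^ n * g z" using z by (simp add: if_distrib cong: if_cong)
  finally show ?thesis .
qed

lemma ft_Parseval:
  "(\<Sum>a\<in>bcube n. ft n g a * ft n h a) = 2 ^ n * (\<Sum>x\<in>bcube n. g x * h x)"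
proof -
  have "(\<Sum>a\<in>bcube n. ft n g a * ft n h a)
      = (\<Sum>a\<in>bcube n. \<Sum>x\<in>bcube n. h x * (ft n g a * chi (dot n a x)))"
    by (subst (2) ft_def) (simp add: sum_distrib_left mult_ac)
  also have "\<dots> = (\<Sum>x\<in>bcube n. \<Sum>a\<in>bcube n. h x * (ft n g a * chi (dot n a x)))"
    by (rule sum.swap)
  also have "\<dots> = (\<Sum>x\<in>bcube n. h x * (2 ^ n * g x))"
    by (simp add: sum_distrib_left[symmetric] ft_inversion)
  finally show ?thesis by (simp add: sum_distrib_left mult_ac)
qed

lemma ft_mult:
  "ft n g a * ft n h a = ft n (\<lambda>u. \<Sum>x\<in>bcube n. g x * h (x + u)) a"
proof -
  have "ft n g a * ft n h a = (\<Sum>x\<in>bcube n. \<Sum>y\<in>bcube n. g x * h y * chi (dot n a (x + y)))"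
    by (simp add: ft_def sum_product dot_add_right chi_add mult_ac)
  also have "\<dots> = (\<Sum>x\<in>bcube n. \<Sum>u\<in>bcube n. g x * h (x + u) * chi (dot n a (x + (x + u))))"
    by (intro sum.cong refl sum_translate'[symmetric])
  also have "\<dots> = (\<Sum>x\<in>bcube n. \<Sum>u\<in>bcube n. g x * h (x + u) * chi (dot n a u))"
    by simp
  also have "\<dots> = (\<Sum>u\<in>bcube n. \<Sum>x\<in>bcube n. g x * h (x + u) * chi (dot n a u))"
    by (rule sum.swap)
  finally show ?thesis by (simp add: ft_def sum_distrib_right)
qed

text \<open>By \<open>ft_mult\<close> the product of the first two transforms is the transform of a
  correlation, and Parseval pairs it with \<open>h\<close>.\<close>

lemma ft_triple:
  "(\<Sum>a\<in>bcube n. ft n f a * ft n g a * ft n h a)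
    = 2 ^ n * (\<Sum>x\<in>bcube n. \<Sum>y\<in>bcube n. f x * g y * h (x + y))"
proof -
  have "(\<Sum>a\<in>bcube n. ft n f a * ft n g a * ft n h a)
     = 2 ^ n * (\<Sum>u\<in>bcube n. \<Sum>x\<in>bcube n. f x * g (x + u) * h u)"
    unfolding ft_mult[of n f _ g] ft_Parseval by (simp add: sum_distrib_right)
  also have "(\<Sum>u\<in>bcube n. \<Sum>x\<in>bcube n. f x * g (x + u) * h u)
     = (\<Sum>x\<in>bcube n. \<Sum>u\<in>bcube n. f x * g (x + u) * h u)" by (rule sum.swap)
  also have "\<dots> = (\<Sum>x\<in>bcube n. \<Sum>y\<in>bcube n. f x * g (x + (x + y)) * h (x + y))"
    by (intro sum.cong refl sum_translate'[symmetric])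
  finally show ?thesis by simp
qed

section \<open>Box correlations, the derivative spectrum and its symplectic self-duality\<close>

definition box_corr :: "nat \<Rightarrow> ((nat \<Rightarrow> bit) \<Rightarrow> real) \<Rightarrow> (nat \<Rightarrow> bit) \<Rightarrow> (nat \<Rightarrow> bit) \<Rightarrow> real" where
  "box_corr n f y h = (\<Sum>x\<in>bcube n. f x * f (x + y) * f (x + h) * f (x + y + h))"

text \<open>The function F of the overview. It takes a pair so that sumset results apply to its
  large values; the normalisation gives every fibre total mass 1 when \<open>f\<close> is a sign
  function.\<close>

definition dspec :: "nat \<Rightarrow> ((nat \<Rightarrow> bit) \<Rightarrow> real) \<Rightarrow> (nat \<Rightarrow> bit) \<times> (nat \<Rightarrow> bit) \<Rightarrow> real" where
  "dspec n f p = (ft n (\<lambda>x. f x * f (x + fst p)) (snd p) / 2 ^ n) ^ 2"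

text \<open>The standard symplectic form; its minus sign is a plus sign in characteristic
  two.\<close>

definition symp_form :: "nat \<Rightarrow> (nat \<Rightarrow> bit) \<times> (nat \<Rightarrow> bit) \<Rightarrow> (nat \<Rightarrow> bit) \<times> (nat \<Rightarrow> bit) \<Rightarrow> bit" where
  "symp_form n p q = dot n (snd p) (fst q) + dot n (fst p) (snd q)"

abbreviation bcube2 :: "nat \<Rightarrow> ((nat \<Rightarrow> bit) \<times> (nat \<Rightarrow> bit)) set" where
  "bcube2 n \<equiv> bcube n \<times> bcube n"

lemma bcube2_add: "p \<in> bcube2 n \<Longrightarrow> q \<in> bcube2 n \<Longrightarrow> p + q \<in> bcube2 n"
  by (auto simp: mem_Times_iff)

lemma subgroup2_bcube2: "subgroup2 (bcube2 n)"
  by (auto simp: subgroup2_def zero_prod_def)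

lemma box_corr_commute: "box_corr n f y h = box_corr n f h y"
  unfolding box_corr_def by (intro sum.cong refl) (simp add: ac_simps)

lemma dspec_nonneg [simp]: "dspec n f p \<ge> 0"
  by (simp add: dspec_def)

lemma dspec_eq_ft_box_corr: "dspec n f (y, a) = ft n (box_corr n f y) a / (2 ^ n) ^ 2"
proof -
  have "(\<lambda>u. \<Sum>x\<in>bcube n. f x * f (x + y) * (f (x + u) * f (x + u + y))) = box_corr n f y"
    unfolding box_corr_def by (intro ext sum.cong refl) (simp add: ac_simps)
  then show ?thesis by (simp add: dspec_def power_divide power2_eq_square ft_mult)
qed

lemma sum_dspec_chi:
  assumes "z \<in> bcube n"
  shows "(\<Sum>a\<in>bcube n. dspec n f (y, a) * chi (dot n a z)) = box_corr n f y z / 2 ^ n"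
  using ft_inversion[OF assms, of "box_corr n f y"]
  by (simp add: dspec_eq_ft_box_corr sum_divide_distrib[symmetric] power2_eq_square)

text \<open>Summing over the frequency \<open>a\<close> undoes one Fourier transform and leaves
  \<open>box_corr n f y z\<close>. Once its directions are exchanged, the sum over \<open>y\<close>
  is a Fourier transform again and rebuilds \<open>dspec\<close> at the point (z, b).\<close>

lemma dspec_symplectic_dual:
  assumes "q \<in> bcube2 n"
  shows "(\<Sum>p\<in>bcube2 n. dspec n f p * chi (symp_form n p q)) = 2 ^ n * dspec n f q"
proof -
  obtain z b where q: "q = (z, b)" by force
  have z: "z \<in> bcube n" using assms q by simp
  have "(\<Sum>p\<in>bcube2 n. dspec n f p * chi (symp_form n p q))
      = (\<Sum>y\<in>bcube n. \<Sum>a\<in>bcube n. dspec n f (y, a) * chi (dot n a z) * chi (dot n b y))"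
    by (simp add: sum.cartesian_product' q symp_form_def chi_add mult.assoc dot_commute)
  also have "\<dots> = (\<Sum>y\<in>bcube n. box_corr n f z y / 2 ^ n * chi (dot n b y))"
    by (simp add: sum_distrib_right[symmetric] sum_dspec_chi[OF z] box_corr_commute)
  also have "\<dots> = ft n (box_corr n f z) b / 2 ^ n"
    by (simp add: ft_def sum_divide_distrib)
  also have "\<dots> = 2 ^ n * dspec n f q"
    by (simp add: q dspec_eq_ft_box_corr power2_eq_square)
  finally show ?thesis .
qed

lemma sum_dspec_fibre:
  assumes f: "\<And>x. x \<in> bcube n \<Longrightarrow> f x ^ 2 = 1" and y: "y \<in> bcube n"
  shows "(\<Sum>a\<in>bcube n. dspec n f (y, a)) = 1"
proof -
  have "box_corr n f y 0 = (\<Sum>x\<in>bcube n. f x ^ 2 * f (x + y) ^ 2)"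
    by (simp add: box_corr_def power2_eq_square mult_ac)
  also have "\<dots> = 2 ^ n" using y by (simp add: f)
  finally show ?thesis using sum_dspec_chi[of 0 n f y] by simp
qed

lemma sum_dspec:
  assumes f: "\<And>x. x \<in> bcube n \<Longrightarrow> f x ^ 2 = 1"
  shows "(\<Sum>p\<in>bcube2 n. dspec n f p) = 2 ^ n"
  using sum_dspec_fibre[OF f] by (simp add: sum.cartesian_product')

lemma sum_dspec_square:
  "(2 ^ n) ^ 3 * (\<Sum>p\<in>bcube2 n. dspec n f p ^ 2) = (\<Sum>y\<in>bcube n. \<Sum>h\<in>bcube n. box_corr n f y h ^ 2)"
proof -
  have "(\<Sum>p\<in>bcube2 n. dspec n f p ^ 2)
      = (\<Sum>y\<in>bcube n. (\<Sum>a\<in>bcube n. ft n (box_corr n f y) a * ft n (box_corr n f y) a) / (2 ^ n) ^ 4)"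
    by (simp add: sum.cartesian_product' dspec_eq_ft_box_corr power_divide sum_divide_distrib power2_eq_square
        eval_nat_numeral mult.assoc)
  also have "\<dots> = (\<Sum>y\<in>bcube n. 2 ^ n * (\<Sum>h\<in>bcube n. box_corr n f y h ^ 2) / (2 ^ n) ^ 4)"
    by (simp add: ft_Parseval power2_eq_square)
  also have "\<dots> = (\<Sum>y\<in>bcube n. \<Sum>h\<in>bcube n. box_corr n f y h ^ 2) / (2 ^ n) ^ 3"
    by (simp add: sum_divide_distrib[symmetric] sum_distrib_left[symmetric] eval_nat_numeral)
  finally show ?thesis by simp
qed

text \<open>Self-duality is used three times: once to expand \<open>dspec n f (p + r)\<close> over
  \<open>q\<close>, where the character splits into a factor for \<open>p\<close> and one for
  \<open>r\<close>, and then to evaluate the sums over \<open>p\<close> and over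
  \<open>r\<close>.\<close>

lemma sum_dspec_triple:
  "(\<Sum>p\<in>bcube2 n. \<Sum>r\<in>bcube2 n. dspec n f p * dspec n f r * dspec n f (p + r))
    = 2 ^ n * (\<Sum>q\<in>bcube2 n. dspec n f q ^ 3)"
proof -
  let ?W = "bcube2 n" and ?F = "dspec n f"
  have symp_add: "chi (symp_form n q (p + r)) = chi (symp_form n p q) * chi (symp_form n r q)" for p q r
    by (simp add: symp_form_def dot_add_right dot_add_left chi_add dot_commute[of n _ "fst q"]
        dot_commute[of n _ "snd q"] mult_ac)
  have "2 ^ n * (\<Sum>p\<in>?W. \<Sum>r\<in>?W. ?F p * ?F r * ?F (p + r))
      = (\<Sum>p\<in>?W. \<Sum>r\<in>?W. ?F p * ?F r * (2 ^ n * ?F (p + r)))"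
    by (simp add: sum_distrib_left mult_ac)
  also have "\<dots> = (\<Sum>p\<in>?W. \<Sum>r\<in>?W. ?F p * ?F r * (\<Sum>q\<in>?W. ?F q * chi (symp_form n q (p + r))))"
    by (intro sum.cong refl) (simp only: dspec_symplectic_dual bcube2_add)
  also have "\<dots> = (\<Sum>p\<in>?W. \<Sum>r\<in>?W. \<Sum>q\<in>?W. ?F q * ((?F p * chi (symp_form n p q)) * (?F r * chi (symp_form n r q))))"
    by (simp add: sum_distrib_left symp_add mult_ac)
  also have "\<dots> = (\<Sum>p\<in>?W. \<Sum>q\<in>?W. \<Sum>r\<in>?W. ?F q * ((?F p * chi (symp_form n p q)) * (?F r * chi (symp_form n r q))))"
    by (intro sum.cong refl sum.swap)
  also have "\<dots> = (\<Sum>q\<in>?W. \<Sum>p\<in>?W. \<Sum>r\<in>?W. ?F q * ((?F p * chi (symp_form n p q)) * (?F r * chi (symp_form n r q))))"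
    by (rule sum.swap)
  also have "\<dots> = (\<Sum>q\<in>?W. ?F q * ((\<Sum>p\<in>?W. ?F p * chi (symp_form n p q)) * (\<Sum>r\<in>?W. ?F r * chi (symp_form n r q))))"
    by (simp only: sum_product) (simp only: sum_distrib_left)
  also have "\<dots> = (\<Sum>q\<in>?W. ?F q * ((2 ^ n * ?F q) * (2 ^ n * ?F q)))"
    by (intro sum.cong refl) (simp only: dspec_symplectic_dual)
  also have "\<dots> = 2 ^ n * (2 ^ n * (\<Sum>q\<in>?W. ?F q ^ 3))"
    by (simp add: sum_distrib_left power3_eq_cube mult_ac)
  finally show ?thesis by simp
qed

text \<open>Writing F^2 as F^(1/2) * F^(3/2), Cauchy--Schwarz bounds the square of the sum of F^2 by
  the sum of F times the sum of F^3.\<close>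

lemma sum_dspec_triple_ge:
  assumes f: "\<And>x. x \<in> bcube n \<Longrightarrow> f x ^ 2 = 1"
    and u: "u * 2 ^ n \<le> (\<Sum>p\<in>bcube2 n. dspec n f p ^ 2)" and u0: "u \<ge> 0"
  shows "u ^ 2 * (2 ^ n) ^ 2 \<le>
    (\<Sum>p\<in>bcube2 n. \<Sum>r\<in>bcube2 n. dspec n f p * dspec n f r * dspec n f (p + r))"
proof -
  let ?W = "bcube2 n" and ?F = "dspec n f"
  have "(u * 2 ^ n) ^ 2 \<le> (\<Sum>p\<in>?W. ?F p ^ 2) ^ 2" using u u0 by (intro power_mono) auto
  also have "\<dots> = (\<Sum>p\<in>?W. sqrt (?F p) * (?F p * sqrt (?F p))) ^ 2"
    by (intro arg_cong[of _ _ "\<lambda>x. x ^ 2"] sum.cong) (auto simp: power2_eq_square mult_ac simp flip: mult.assoc)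
  also have "\<dots> \<le> (\<Sum>p\<in>?W. sqrt (?F p) ^ 2) * (\<Sum>p\<in>?W. (?F p * sqrt (?F p)) ^ 2)"
    by (rule Cauchy_Schwarz_ineq_sum)
  also have "\<dots> = 2 ^ n * (\<Sum>p\<in>?W. ?F p ^ 3)"
    using sum_dspec[OF f] by (simp add: power_mult_distrib eval_nat_numeral mult_ac)
  also have "\<dots> = (\<Sum>p\<in>?W. \<Sum>r\<in>?W. ?F p * ?F r * ?F (p + r))" by (rule sum_dspec_triple[symmetric])
  finally show ?thesis by (simp add: power_mult_distrib)
qed

lemma sum_translate2:
  assumes "t \<in> bcube2 n"
  shows "(\<Sum>p\<in>bcube2 n. g (t + p)) = (\<Sum>p\<in>bcube2 n. g p)"
proof -
  have c: "t + (t + p) = p" for p using bvec_pair_add_self[of t] by (simp add: add.assoc[symmetric])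
  show ?thesis
    by (rule sum.reindex_bij_witness[of _ "\<lambda>p. t + p" "\<lambda>p. t + p"]) (use assms bcube2_add c in auto)
qed

lemma dspec_le_1:
  assumes f: "\<And>x. x \<in> bcube n \<Longrightarrow> f x ^ 2 = 1" and p: "p \<in> bcube2 n"
  shows "dspec n f p \<le> 1"
proof -
  have "dspec n f (fst p, snd p) \<le> (\<Sum>a\<in>bcube n. dspec n f (fst p, a))"
    using p by (intro member_le_sum) auto
  also have "\<dots> = 1" using sum_dspec_fibre[OF f] p by auto
  finally show ?thesis by simp
qed

text \<open>A triple with a member below u^2 / 6 contributes at most u^2 / 6 times the product of
  the other two values. Each of the three such products sums to N^2 over all pairs, so small members
  account for at most half of u^2 N^2. The remaining triples contribute at most 1 each, because F
  \<le> 1.\<close>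

lemma large_spectrum_many_sums:
  fixes u :: real
  assumes f: "\<And>x. x \<in> bcube n \<Longrightarrow> f x ^ 2 = 1"
    and u: "u * 2 ^ n \<le> (\<Sum>p\<in>bcube2 n. dspec n f p ^ 2)" and u0: "u > 0"
  defines "A \<equiv> {p \<in> bcube2 n. u ^ 2 / 6 \<le> dspec n f p}"
  shows "u ^ 2 / 2 * (2 ^ n) ^ 2 \<le> card {(p, r) \<in> A \<times> A. p + r \<in> A}"
proof -
  let ?W = "bcube2 n" and ?F = "dspec n f" and ?\<delta> = "u ^ 2 / 6"
  have F: "0 \<le> ?F p" "p \<in> ?W \<Longrightarrow> ?F p \<le> 1" for p using dspec_le_1[OF f] by auto
  have sF: "(\<Sum>p\<in>?W. ?F p) = 2 ^ n" by (rule sum_dspec[OF f])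
  have d0: "?\<delta> \<ge> 0" by simp
  have "u ^ 2 * (2 ^ n) ^ 2 \<le> (\<Sum>p\<in>?W. \<Sum>r\<in>?W. ?F p * ?F r * ?F (p + r))"
    using sum_dspec_triple_ge[OF f u] u0 by simp
  also have "\<dots> \<le> (\<Sum>p\<in>?W. \<Sum>r\<in>?W. of_bool (p \<in> A \<and> r \<in> A \<and> p + r \<in> A)
      + ?\<delta> * (?F p * ?F r + ?F p * ?F (p + r) + ?F r * ?F (p + r)))"
  proof (intro sum_mono)
    fix p r assume pr: "p \<in> ?W" "r \<in> ?W"
    have s: "p + r \<in> ?W" using pr by (rule bcube2_add)
    have nn: "0 \<le> ?F p * ?F r" "0 \<le> ?F p * ?F (p + r)" "0 \<le> ?F r * ?F (p + r)"
      using F by simp_all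
    have nd: "0 \<le> ?\<delta> * (?F p * ?F r)" "0 \<le> ?\<delta> * (?F p * ?F (p + r))" "0 \<le> ?\<delta> * (?F r * ?F (p + r))"
      using nn by simp_all
    have b0: "0 \<le> (of_bool (p \<in> A \<and> r \<in> A \<and> p + r \<in> A) :: real)" by simp
    have le1: "?F p * ?F r * ?F (p + r) \<le> 1"
      using F pr s by (intro mult_le_one mult_nonneg_nonneg) auto
    have small: "x * z \<le> ?\<delta> * z" if "x < ?\<delta>" "0 \<le> z" for x z
      using that by (intro mult_right_mono) auto
    consider "p \<in> A \<and> r \<in> A \<and> p + r \<in> A" | "?F p < ?\<delta>" | "?F r < ?\<delta>" | "?F (p + r) < ?\<delta>"
      using pr s by (force simp: A_def)
    then show "?F p * ?F r * ?F (p + r) \<le> of_bool (p \<in> A \<and> r \<in> A \<and> p + r \<in> A)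
        + ?\<delta> * (?F p * ?F r + ?F p * ?F (p + r) + ?F r * ?F (p + r))"
    proof cases
      case 1
      then have "of_bool (p \<in> A \<and> r \<in> A \<and> p + r \<in> A) = (1 :: real)" by simp
      then show ?thesis using nd le1 unfolding distrib_left by linarith
    next
      case 2
      have "?F p * ?F r * ?F (p + r) = ?F p * (?F r * ?F (p + r))" by simp
      then show ?thesis using small[OF 2 nn(3)] nd b0 unfolding distrib_left by linarith
    next
      case 3
      have "?F p * ?F r * ?F (p + r) = ?F r * (?F p * ?F (p + r))" by simp
      then show ?thesis using small[OF 3 nn(2)] nd b0 unfolding distrib_left by linarith
    next
      case 4
      have "?F p * ?F r * ?F (p + r) = ?F (p + r) * (?F p * ?F r)" by simp
      then show ?thesis using small[OF 4 nn(1)] nd b0 unfolding distrib_left by linarith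
    qed
  qed
  also have "\<dots> = (\<Sum>p\<in>?W. \<Sum>r\<in>?W. of_bool (p \<in> A \<and> r \<in> A \<and> p + r \<in> A)) + ?\<delta> * (3 * (2 ^ n) ^ 2)"
  proof -
    have 1: "(\<Sum>p\<in>?W. \<Sum>r\<in>?W. ?F p * ?F r) = (2 ^ n) ^ 2"
      by (simp only: sum_product[symmetric] sF power2_eq_square)
    have 2: "(\<Sum>p\<in>?W. \<Sum>r\<in>?W. ?F p * ?F (p + r)) = (2 ^ n) ^ 2"
    proof -
      have "(\<Sum>p\<in>?W. \<Sum>r\<in>?W. ?F p * ?F (p + r)) = (\<Sum>p\<in>?W. ?F p * (\<Sum>r\<in>?W. ?F (p + r)))"
        by (simp only: sum_distrib_left)
      also have "\<dots> = (\<Sum>p\<in>?W. ?F p * (\<Sum>r\<in>?W. ?F r))"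
        by (intro sum.cong refl) (simp only: sum_translate2)
      finally show ?thesis by (simp only: sum_distrib_right[symmetric] sF power2_eq_square)
    qed
    have "(\<Sum>p\<in>?W. \<Sum>r\<in>?W. ?F r * ?F (p + r)) = (\<Sum>p\<in>?W. \<Sum>r\<in>?W. ?F p * ?F (p + r))"
      by (subst sum.swap) (simp add: add.commute)
    with 1 2 show ?thesis
      by (simp only: sum.distrib sum_distrib_left[symmetric]) (simp add: algebra_simps)
  qed
  also have "(\<Sum>p\<in>?W. \<Sum>r\<in>?W. of_bool (p \<in> A \<and> r \<in> A \<and> p + r \<in> A))
      = real (card {(p, r) \<in> A \<times> A. p + r \<in> A})"
  proof -
    have "(\<Sum>p\<in>?W. \<Sum>r\<in>?W. of_bool (p \<in> A \<and> r \<in> A \<and> p + r \<in> A))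
        = (\<Sum>z\<in>?W \<times> ?W. of_bool (fst z \<in> A \<and> snd z \<in> A \<and> fst z + snd z \<in> A) :: real)"
      by (simp only: sum.cartesian_product' fst_conv snd_conv)
    also have "\<dots> = real (card ((?W \<times> ?W) \<inter> {z. fst z \<in> A \<and> snd z \<in> A \<and> fst z + snd z \<in> A}))"
      by (simp only: of_bool_def, subst sum.If_cases) auto
    also have "(?W \<times> ?W) \<inter> {z. fst z \<in> A \<and> snd z \<in> A \<and> fst z + snd z \<in> A}
        = {(p, r) \<in> A \<times> A. p + r \<in> A}" by (auto simp: A_def)
    finally show ?thesis .
  qed
  finally show ?thesis by (simp add: algebra_simps)
qed

text \<open>The triple count is relative to N^2 but is needed relative to |A|^2; since the mass N
  forces |A| \<le> N / \<delta>, the proportion becomes c = \<tau> \<delta>^2. The retained mass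
  \<delta> c \<tau> / 4 is the value \<delta> per point, times the proportion c / 4 of
  \<open>A\<close> in \<open>H\<close>, times the lower bound \<tau> for |A| / N.\<close>

lemma spectrum_concentrates_on_subgroup:
  fixes u \<delta> \<tau> c K :: real
  assumes f: "\<And>x. x \<in> bcube n \<Longrightarrow> f x ^ 2 = 1"
    and u: "u * 2 ^ n \<le> (\<Sum>p\<in>bcube2 n. dspec n f p ^ 2)" and u0: "0 < u" "u \<le> 1"
  defines "\<delta> \<equiv> u ^ 2 / 6" and "\<tau> \<equiv> u ^ 2 / 2"
  defines "c \<equiv> \<tau> * \<delta> ^ 2"
  defines "K \<equiv> 4096 / c ^ 6"
  shows "\<exists>H. subgroup2 H \<and> H \<subseteq> bcube2 n \<and> real (card H) \<le> 2 powr (K ^ 4) * K / \<delta> * 2 ^ n \<and>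
    \<delta> * c * \<tau> / 4 * 2 ^ n \<le> (\<Sum>p\<in>H. dspec n f p)"
proof -
  let ?F = "dspec n f"
  define A where "A = {p \<in> bcube2 n. \<delta> \<le> ?F p}"
  have finA: "finite A" by (simp add: A_def)
  have pos: "\<delta> > 0" "\<tau> > 0" "c > 0" using u0 by (simp_all add: \<delta>_def \<tau>_def c_def)
  have "\<tau> \<le> 1" using u0 power_le_one[of u 2] by (simp add: \<tau>_def)
  have many: "\<tau> * (2 ^ n) ^ 2 \<le> card {(p, r) \<in> A \<times> A. p + r \<in> A}"
    using large_spectrum_many_sums[OF f u u0(1)] by (simp add: A_def \<delta>_def \<tau>_def)
  have "card {(p, r) \<in> A \<times> A. p + r \<in> A} \<le> card (A \<times> A)"
    using finA by (intro card_mono) auto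
  then have "card {(p, r) \<in> A \<times> A. p + r \<in> A} \<le> card A * card A"
    by (simp add: card_cartesian_product)
  then have m2: "\<tau> * (2 ^ n) ^ 2 \<le> real (card A) ^ 2"
    using many unfolding power2_eq_square of_nat_mult[symmetric] by linarith
  have "(\<tau> * 2 ^ n) ^ 2 \<le> \<tau> * (2 ^ n) ^ 2"
    using \<open>\<tau> \<le> 1\<close> pos by (simp add: power_mult_distrib power2_eq_square[of \<tau>] mult_le_one)
  then have "(\<tau> * 2 ^ n) ^ 2 \<le> real (card A) ^ 2" using m2 by (rule order_trans)
  then have mge: "\<tau> * 2 ^ n \<le> card A" by (rule power2_le_imp_le) simp
  have "0 < \<tau> * 2 ^ n" using pos by simp
  then have neA: "A \<noteq> {}" using mge by auto
  have mle: "\<delta> * card A \<le> 2 ^ n"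
  proof -
    have "\<delta> * card A = (\<Sum>p\<in>A. \<delta>)" by simp
    also have "\<dots> \<le> (\<Sum>p\<in>A. ?F p)" by (intro sum_mono) (simp add: A_def)
    also have "\<dots> \<le> (\<Sum>p\<in>bcube2 n. ?F p)" by (intro sum_mono2) (auto simp: A_def)
    finally show ?thesis by (simp add: sum_dspec[OF f])
  qed
  have "c * card A ^ 2 = \<tau> * (\<delta> * card A) ^ 2" by (simp add: c_def power_mult_distrib)
  also have "\<dots> \<le> \<tau> * (2 ^ n) ^ 2" using mle pos by (intro mult_left_mono power_mono) auto
  finally have "c * card A ^ 2 \<le> card {(p, r) \<in> A \<times> A. p + r \<in> A}" using many by simp
  then obtain H where H: "subgroup2 H" "finite H" "real (card H) \<le> 2 powr (K ^ 4) * K * card A"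
      "c * card A / 4 \<le> card (A \<inter> H)" and Hmin: "\<And>G. subgroup2 G \<Longrightarrow> A \<subseteq> G \<Longrightarrow> H \<subseteq> G"
    using many_sums_subgroup[OF bvec_pair_add_self finA neA pos(3)] unfolding K_def by blast
  have HW: "H \<subseteq> bcube2 n" by (rule Hmin[OF subgroup2_bcube2]) (auto simp: A_def)
  have K0: "K \<ge> 0" using pos by (simp add: K_def)
  have "real (card H) \<le> 2 powr (K ^ 4) * K * (2 ^ n / \<delta>)"
    using H(3) mle pos K0 by (elim order_trans, intro mult_left_mono) (auto simp: field_simps)
  moreover have "\<delta> * c * \<tau> / 4 * 2 ^ n \<le> (\<Sum>p\<in>H. ?F p)"
  proof -
    have "\<delta> * c * \<tau> / 4 * 2 ^ n = \<delta> * (c * (\<tau> * 2 ^ n) / 4)" by simp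
    also have "\<dots> \<le> \<delta> * (c * card A / 4)" using mge pos by (intro mult_left_mono divide_right_mono) auto
    also have "\<dots> \<le> \<delta> * card (A \<inter> H)" using H(4) pos by (intro mult_left_mono) auto
    also have "\<dots> = (\<Sum>p\<in>A \<inter> H. \<delta>)" by simp
    also have "\<dots> \<le> (\<Sum>p\<in>A \<inter> H. ?F p)" by (intro sum_mono) (simp add: A_def)
    also have "\<dots> \<le> (\<Sum>p\<in>H. ?F p)" using H(2) by (intro sum_mono2) auto
    finally show ?thesis .
  qed
  ultimately show ?thesis using H(1) HW by (intro exI[of _ H]) simp
qed

section \<open>Linear algebra over F_2 and the passage to an affine graph\<close>

definition scale_bvec :: "bit \<Rightarrow> (nat \<Rightarrow> bit) \<Rightarrow> nat \<Rightarrow> bit" where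
  "scale_bvec c x = (\<lambda>i. c * x i)"

definition scale_bvec2 :: "bit \<Rightarrow> (nat \<Rightarrow> bit) \<times> (nat \<Rightarrow> bit) \<Rightarrow> (nat \<Rightarrow> bit) \<times> (nat \<Rightarrow> bit)" where
  "scale_bvec2 c p = (scale_bvec c (fst p), scale_bvec c (snd p))"

lemma vector_space_bvec: "vector_space scale_bvec"
  by unfold_locales (auto simp: scale_bvec_def fun_eq_iff algebra_simps)

lemma vector_space_bvec2: "vector_space scale_bvec2"
  by unfold_locales (auto simp: scale_bvec2_def scale_bvec_def fun_eq_iff algebra_simps plus_prod_def)

lemma scale_bvec_simps [simp]: "scale_bvec 0 x = 0" "scale_bvec 1 x = x"
  "scale_bvec2 0 p = 0" "scale_bvec2 1 p = p"
  by (auto simp: scale_bvec2_def scale_bvec_def fun_eq_iff zero_prod_def)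

lemma additive_section:
  fixes H :: "((nat \<Rightarrow> bit) \<times> (nat \<Rightarrow> bit)) set"
  assumes "subgroup2 H"
  shows "\<exists>M. (\<forall>x y. M (x + y) = M x + M y) \<and> range M \<subseteq> snd ` H \<and> (\<forall>y\<in>fst ` H. (y, M y) \<in> H)"
proof -
  interpret vector_space_pair scale_bvec2 scale_bvec
    by (intro vector_space_pair.intro vector_space_bvec vector_space_bvec2)
  have "module.subspace scale_bvec2 H"
    unfolding vs1.subspace_def
  proof (intro conjI allI ballI)
    fix c :: bit and x assume "x \<in> H"
    then show "scale_bvec2 c x \<in> H" using assms by (cases c) (auto simp: subgroup2_def)
  qed (use assms in \<open>auto simp: subgroup2_def\<close>)
  moreover have "Vector_Spaces.linear scale_bvec2 scale_bvec fst"
    unfolding Vector_Spaces.linear_iff by (simp add: scale_bvec2_def vector_space_bvec vector_space_bvec2)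
  ultimately obtain g where g: "range g \<subseteq> H" "Vector_Spaces.linear scale_bvec scale_bvec2 g"
      "\<forall>v\<in>fst ` H. fst (g v) = v"
    using linear_exists_right_inverse_on by blast
  have add: "g (x + y) = g x + g y" for x y
    using g(2) by (simp add: Vector_Spaces.linear_iff)
  show ?thesis
  proof (intro exI[of _ "\<lambda>v. snd (g v)"] conjI allI ballI)
    fix y assume "y \<in> fst ` H"
    then have "(y, snd (g y)) = g y" using g(3) by (metis prod.collapse)
    then show "(y, snd (g y)) \<in> H" using g(1) by auto
  qed (use g(1) in \<open>auto simp: add\<close>)
qed

text \<open>A section of the diagonal copy of \<open>U\<close> is a projection onto
  \<open>U\<close>.\<close>

lemma additive_projection:
  fixes U :: "(nat \<Rightarrow> bit) set"
  assumes "subgroup2 U"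
  shows "\<exists>P. (\<forall>x y. P (x + y) = P x + P y) \<and> range P \<subseteq> U \<and> (\<forall>u\<in>U. P u = u)"
proof -
  have "subgroup2 ((\<lambda>u. (u, u)) ` U)"
    using assms by (auto simp: subgroup2_def zero_prod_def)
  from additive_section[OF this] obtain M where "\<forall>x y. M (x + y) = M x + M y"
    "range M \<subseteq> snd ` ((\<lambda>u. (u, u)) ` U)" "\<forall>y\<in>fst ` (\<lambda>u. (u, u)) ` U. (y, M y) \<in> (\<lambda>u. (u, u)) ` U"
    by blast
  then show ?thesis by (intro exI[of _ M]) (auto simp: image_image)
qed

text \<open>\<open>H\<close> is the disjoint union of the graphs of y -> M y + w over
  \<open>U\<close>, with \<open>w\<close> in the vertical part \<open>W\<close>. The mass on
  \<open>H\<close> is at most |U|, as fibres have mass 1, so |U| \<ge> \<theta> N; together with |U|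
  |W| = |H| \<le> L N this gives |W| \<le> L / \<theta>. The best \<open>w\<close> keeps the average
  share of the mass.\<close>

lemma spectrum_affine_graph:
  fixes L \<theta> :: real
  assumes f: "\<And>x. x \<in> bcube n \<Longrightarrow> f x ^ 2 = 1"
    and H: "subgroup2 H" "H \<subseteq> bcube2 n"
    and L: "real (card H) \<le> L * 2 ^ n" and \<theta>: "\<theta> > 0" "\<theta> * 2 ^ n \<le> (\<Sum>p\<in>H. dspec n f p)"
  shows "\<exists>M w. (\<forall>x y. M (x + y) = M x + M y) \<and>
    \<theta> ^ 2 / L * 2 ^ n \<le> (\<Sum>y\<in>bcube n. dspec n f (y, M y + w))"
proof -
  let ?F = "dspec n f"
  define U where "U = fst ` H"
  define W where "W = {w. (0, w) \<in> H}"
  obtain M where M: "\<And>x y. M (x + y) = M x + M y" "\<And>y. y \<in> U \<Longrightarrow> (y, M y) \<in> H"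
    using additive_section[OF H(1)] unfolding U_def by blast
  have finH: "finite H" using H(2) by (rule finite_subset) simp
  have UV: "U \<subseteq> bcube n" and WV: "W \<subseteq> bcube n" using H(2) by (auto simp: U_def W_def)
  have finU: "finite U" and finW: "finite W" using UV WV finite_subset bcube_card(1) by blast+
  have "0 \<in> W" using H(1) by (simp add: W_def subgroup2_def zero_prod_def)
  then have cW: "card W > 0" using finW by (auto simp: card_gt_0_iff)
  have bij: "bij_betw (\<lambda>(y, w). (y, M y + w)) (U \<times> W) H"
  proof (rule bij_betw_byWitness[where f' = "\<lambda>(y, a). (y, M y + a)"])
    show "(\<lambda>(y, w). (y, M y + w)) ` (U \<times> W) \<subseteq> H"
    proof clarify
      fix y w assume "y \<in> U" "w \<in> W"
      then have "(y, M y) \<in> H" "(0, w) \<in> H" using M(2) by (auto simp: W_def)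
      then have "(y, M y) + (0, w) \<in> H" using H(1) unfolding subgroup2_def by blast
      then show "(y, M y + w) \<in> H" by simp
    qed
    show "(\<lambda>(y, a). (y, M y + a)) ` H \<subseteq> U \<times> W"
    proof clarify
      fix y a assume ya: "(y, a) \<in> H"
      then have yU: "y \<in> U" by (force simp: U_def)
      then have "(y, M y) + (y, a) \<in> H" using H(1) M(2) ya unfolding subgroup2_def by blast
      then show "y \<in> U \<and> M y + a \<in> W" using yU by (simp add: W_def)
    qed
  qed auto
  have cH: "card H = card U * card W"
    using bij_betw_same_card[OF bij] by (simp add: card_cartesian_product)
  define S where "S = (\<Sum>p\<in>H. ?F p)"
  have S_eq: "S = (\<Sum>w\<in>W. \<Sum>y\<in>U. ?F (y, M y + w))"
  proof -
    have "S = (\<Sum>z\<in>U \<times> W. ?F (case z of (y, w) \<Rightarrow> (y, M y + w)))"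
      unfolding S_def by (rule sum.reindex_bij_betw[OF bij, symmetric])
    also have "\<dots> = (\<Sum>y\<in>U. \<Sum>w\<in>W. ?F (y, M y + w))" by (simp add: sum.cartesian_product')
    finally show ?thesis by (subst sum.swap)
  qed
  have SU: "S \<le> card U"
  proof -
    have HU: "H \<subseteq> U \<times> bcube n" using H(2) by (force simp: U_def)
    have "S \<le> (\<Sum>p\<in>U \<times> bcube n. ?F p)"
      unfolding S_def using finU HU by (intro sum_mono2) auto
    also have "\<dots> = (\<Sum>y\<in>U. \<Sum>a\<in>bcube n. ?F (y, a))" by (simp add: sum.cartesian_product')
    also have "\<dots> = (\<Sum>y\<in>U. 1)" using UV sum_dspec_fibre[OF f] by (intro sum.cong) auto
    finally show ?thesis by simp
  qed
  have S\<theta>: "\<theta> * 2 ^ n \<le> S" using \<theta>(2) by (simp add: S_def)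
  have Wle: "\<theta> * card W \<le> L"
  proof -
    have "\<theta> * card W * 2 ^ n \<le> S * card W" using mult_right_mono[OF S\<theta>, of "card W"] by (simp add: mult_ac)
    also have "\<dots> \<le> real (card U) * card W" using SU by (intro mult_right_mono) auto
    also have "\<dots> \<le> L * 2 ^ n" using L cH by simp
    finally show ?thesis by simp
  qed
  have L0: "L > 0" using Wle cW \<theta>(1) by (smt (verit) mult_pos_pos of_nat_0_less_iff)
  have "\<exists>w\<in>W. \<theta> ^ 2 / L * 2 ^ n \<le> (\<Sum>y\<in>U. ?F (y, M y + w))"
  proof (rule ccontr)
    assume "\<not> ?thesis"
    then have "(\<Sum>w\<in>W. \<Sum>y\<in>U. ?F (y, M y + w)) < (\<Sum>w\<in>W. \<theta> ^ 2 / L * 2 ^ n)"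
      using finW \<open>0 \<in> W\<close> by (intro sum_strict_mono) (auto simp: not_le)
    also have "\<dots> = \<theta> / L * 2 ^ n * (\<theta> * card W)" by (simp add: power2_eq_square)
    also have "\<dots> \<le> \<theta> / L * 2 ^ n * L" using Wle \<theta>(1) L0 by (intro mult_left_mono) auto
    also have "\<dots> = \<theta> * 2 ^ n" using L0 by simp
    finally show False using S\<theta> S_eq by simp
  qed
  then obtain w where w: "w \<in> W" "\<theta> ^ 2 / L * 2 ^ n \<le> (\<Sum>y\<in>U. ?F (y, M y + w))" by blast
  note w(2)
  also have "(\<Sum>y\<in>U. ?F (y, M y + w)) \<le> (\<Sum>y\<in>bcube n. ?F (y, M y + w))"
    using UV by (intro sum_mono2) auto
  finally have "\<theta> ^ 2 / L * 2 ^ n \<le> (\<Sum>y\<in>bcube n. ?F (y, M y + w))" .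
  then show ?thesis using M(1) by blast
qed

section \<open>Quadratic phases\<close>

text \<open>Required for all vectors rather than those of the cube, so that rewriting with it leaves
  no membership conditions.\<close>

definition biadditive :: "((nat \<Rightarrow> bit) \<Rightarrow> (nat \<Rightarrow> bit) \<Rightarrow> bit) \<Rightarrow> bool" where
  "biadditive B \<longleftrightarrow> (\<forall>x y z. B (x + y) z = B x z + B y z \<and> B x (y + z) = B x y + B x z)"

lemma biadditive_simps:
  assumes "biadditive B"
  shows "B (x + y) z = B x z + B y z" "B x (y + z) = B x y + B x z" "B 0 x = 0" "B x 0 = 0"
proof -
  show a: "B (x + y) z = B x z + B y z" "B x (y + z) = B x y + B x z" for x y z
    using assms by (simp_all add: biadditive_def)
  show "B 0 x = 0" using a(1)[of 0 0 x] by simp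
  show "B x 0 = 0" using a(2)[of x 0 0] by simp
qed

text \<open>Cauchy--Schwarz in \<open>x\<close> removes \<open>a\<close>. After squaring, the sum
  over \<open>x\<close> of \<open>chi (D x (y + z))\<close> vanishes unless y + z lies in the right
  radical of \<open>D\<close>, which is what the bound counts.\<close>

lemma bilinear_form_sum_bound:
  fixes a b :: "(nat \<Rightarrow> bit) \<Rightarrow> real"
  assumes D: "biadditive D"
    and a: "\<And>x. x \<in> bcube n \<Longrightarrow> \<bar>a x\<bar> = 1" and b: "\<And>x. x \<in> bcube n \<Longrightarrow> \<bar>b x\<bar> = 1"
  shows "(\<Sum>x\<in>bcube n. \<Sum>y\<in>bcube n. a x * b y * chi (D x y)) ^ 2
    \<le> (2 ^ n) ^ 3 * card {z \<in> bcube n. \<forall>x\<in>bcube n. D x z = 0}"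
proof -
  let ?V = "bcube n"
  define T where "T = (\<lambda>x. \<Sum>y\<in>?V. b y * chi (D x y))"
  have "(\<Sum>x\<in>?V. \<Sum>y\<in>?V. a x * b y * chi (D x y)) ^ 2 = (\<Sum>x\<in>?V. a x * T x) ^ 2"
    by (simp add: T_def sum_distrib_left mult.assoc)
  also have "\<dots> \<le> (\<Sum>x\<in>?V. a x ^ 2) * (\<Sum>x\<in>?V. T x ^ 2)" by (rule Cauchy_Schwarz_ineq_sum)
  also have "(\<Sum>x\<in>?V. a x ^ 2) = 2 ^ n"
  proof -
    have "a x ^ 2 = 1" if "x \<in> ?V" for x using a[OF that] by (metis power2_abs power_one)
    then show ?thesis by simp
  qed
  also have "(\<Sum>x\<in>?V. T x ^ 2) \<le> (2 ^ n) ^ 2 * card {z \<in> ?V. \<forall>x\<in>?V. D x z = 0}"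
  proof -
    have "(\<Sum>x\<in>?V. T x ^ 2) = (\<Sum>x\<in>?V. \<Sum>y\<in>?V. \<Sum>z\<in>?V. b y * b z * chi (D x (y + z)))"
      by (simp add: T_def power2_eq_square sum_product biadditive_simps[OF D] chi_add mult_ac)
    also have "\<dots> = (\<Sum>x\<in>?V. \<Sum>y\<in>?V. \<Sum>z\<in>?V. b y * b (y + z) * chi (D x (y + (y + z))))"
      by (intro sum.cong refl sum_translate'[symmetric])
    also have "\<dots> = (\<Sum>y\<in>?V. \<Sum>x\<in>?V. \<Sum>z\<in>?V. b y * b (y + z) * chi (D x z))"
      by (subst sum.swap) simp
    also have "\<dots> = (\<Sum>y\<in>?V. \<Sum>z\<in>?V. \<Sum>x\<in>?V. b y * b (y + z) * chi (D x z))"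
      by (intro sum.cong refl sum.swap)
    also have "\<dots> = (\<Sum>y\<in>?V. \<Sum>z\<in>?V. b y * b (y + z) * (if \<forall>x\<in>?V. D x z = 0 then 2 ^ n else 0))"
      by (simp add: sum_distrib_left[symmetric] sum_chi_additive biadditive_simps[OF D])
    also have "\<dots> \<le> (\<Sum>y\<in>?V. \<Sum>z\<in>?V. (if \<forall>x\<in>?V. D x z = 0 then 2 ^ n else 0))"
    proof (intro sum_mono)
      fix y z assume yz: "y \<in> ?V" "z \<in> ?V"
      then have "\<bar>b y * b (y + z)\<bar> = 1" using b by (simp add: abs_mult)
      then have "b y * b (y + z) \<le> 1" by linarith
      then show "b y * b (y + z) * (if \<forall>x\<in>?V. D x z = 0 then 2 ^ n else 0)
          \<le> (if \<forall>x\<in>?V. D x z = 0 then 2 ^ n else 0)" by simp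
    qed
    also have "\<dots> = (\<Sum>y\<in>?V. 2 ^ n * real (card {z \<in> ?V. \<forall>x\<in>?V. D x z = 0}))"
      by (simp add: sum.If_cases Int_def)
    also have "\<dots> = (2 ^ n) ^ 2 * card {z \<in> ?V. \<forall>x\<in>?V. D x z = 0}"
      by (simp add: power2_eq_square)
    finally show ?thesis .
  qed
  finally show ?thesis by (simp add: eval_nat_numeral mult_ac)
qed

text \<open>The substitution h = y + s followed by y = x + z turns the box phase B y h into a phase with
  mixed part B x z + B z x, in which the rest of the summand splits into functions of x and of z.\<close>

lemma box_phase_symmetry:
  assumes f: "\<And>x. x \<in> bcube n \<Longrightarrow> \<bar>f x\<bar> = 1" and B: "biadditive B" and \<eta>: "\<eta> \<ge> 0"
    and big: "\<eta> * (2 ^ n) ^ 3 \<le> (\<Sum>y\<in>bcube n. \<Sum>h\<in>bcube n. box_corr n f y h * chi (B y h + dot n w h))"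
  shows "\<eta> ^ 2 * 2 ^ n \<le> card {z \<in> bcube n. \<forall>x\<in>bcube n. B x z = B z x}"
proof -
  let ?V = "bcube n"
  define a where "a = (\<lambda>s x. f x * f (x + s) * chi (B x x + B x s + dot n w x))"
  define D where "D = (\<lambda>x z. B x z + B z x)"
  have D: "biadditive D" using B by (simp add: biadditive_def D_def add_ac)
  define G where "G = (\<lambda>s. \<Sum>x\<in>?V. \<Sum>z\<in>?V. a s x * a s z * chi (D x z))"
  define \<Psi> where "\<Psi> = (\<lambda>x y h. f x * f (x + y) * f (x + h) * f (x + y + h) * chi (B y h + dot n w h))"
  have \<Psi>_eq: "\<Psi> x (x + z) (x + z + s) = chi (dot n w s) * (a s x * a s z * chi (D x z))"
    if "x \<in> ?V" "z \<in> ?V" "s \<in> ?V" for x z s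
    by (simp add: \<Psi>_def a_def D_def biadditive_simps[OF B] dot_add_right chi_add add_ac mult_ac)
  have "(\<Sum>y\<in>?V. \<Sum>h\<in>?V. box_corr n f y h * chi (B y h + dot n w h)) = (\<Sum>y\<in>?V. \<Sum>h\<in>?V. \<Sum>x\<in>?V. \<Psi> x y h)"
    by (simp add: box_corr_def \<Psi>_def sum_distrib_right)
  also have "\<dots> = (\<Sum>y\<in>?V. \<Sum>s\<in>?V. \<Sum>x\<in>?V. \<Psi> x y (y + s))"
    by (intro sum.cong refl sum_translate'[symmetric])
  also have "\<dots> = (\<Sum>s\<in>?V. \<Sum>y\<in>?V. \<Sum>x\<in>?V. \<Psi> x y (y + s))" by (rule sum.swap)
  also have "\<dots> = (\<Sum>s\<in>?V. \<Sum>x\<in>?V. \<Sum>y\<in>?V. \<Psi> x y (y + s))" by (intro sum.cong refl sum.swap)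
  also have "\<dots> = (\<Sum>s\<in>?V. \<Sum>x\<in>?V. \<Sum>z\<in>?V. \<Psi> x (x + z) (x + z + s))"
    by (intro sum.cong refl sum_translate'[symmetric])
  also have "\<dots> = (\<Sum>s\<in>?V. chi (dot n w s) * G s)"
    by (simp add: \<Psi>_eq G_def sum_distrib_left)
  finally have eq: "(\<Sum>y\<in>?V. \<Sum>h\<in>?V. box_corr n f y h * chi (B y h + dot n w h)) = (\<Sum>s\<in>?V. chi (dot n w s) * G s)" .
  \<comment> \<open>One good \<open>s\<close> suffices: \<open>s\<close> enters only the unimodular
    factors \<open>a s\<close>, while the form \<open>D\<close> does not depend on it.\<close>
  have "\<exists>s\<in>?V. \<eta> * (2 ^ n) ^ 2 \<le> \<bar>G s\<bar>"
  proof (rule ccontr)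
    assume n: "\<not> ?thesis"
    have "(\<Sum>s\<in>?V. chi (dot n w s) * G s) \<le> (\<Sum>s\<in>?V. \<bar>G s\<bar>)"
      by (intro sum_mono) (auto simp: chi_def)
    also have "\<dots> < (\<Sum>s\<in>?V. \<eta> * (2 ^ n) ^ 2)"
      using n by (intro sum_strict_mono) (auto simp: not_le)
    also have "\<dots> = \<eta> * (2 ^ n) ^ 3" by (simp add: eval_nat_numeral)
    finally show False using big eq by simp
  qed
  then obtain s where s: "s \<in> ?V" "\<eta> * (2 ^ n) ^ 2 \<le> \<bar>G s\<bar>" by blast
  have a1: "\<bar>a s x\<bar> = 1" if "x \<in> ?V" for x using f that s(1) by (simp add: a_def abs_mult)
  have "(\<eta> * (2 ^ n) ^ 2) ^ 2 \<le> \<bar>G s\<bar> ^ 2" using s(2) \<eta> by (intro power_mono) auto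
  also have "\<dots> = G s ^ 2" by simp
  also have "\<dots> \<le> (2 ^ n) ^ 3 * card {z \<in> ?V. \<forall>x\<in>?V. D x z = 0}"
    unfolding G_def by (rule bilinear_form_sum_bound[OF D a1 a1])
  finally have "(2 ^ n) ^ 3 * (\<eta> ^ 2 * 2 ^ n) \<le> (2 ^ n) ^ 3 * real (card {z \<in> ?V. \<forall>x\<in>?V. D x z = 0})"
    by (simp add: power_mult_distrib eval_nat_numeral mult_ac)
  moreover have "D x z = 0 \<longleftrightarrow> B x z = B z x" for x z
    unfolding D_def by (cases "B x z"; cases "B z x") auto
  ultimately show ?thesis by simp
qed

text \<open>Symmetry does not force a zero diagonal in characteristic two. But on \<open>U\<close>
  the cross terms of B (x + y) (x + y) cancel, so z -> B z z is additive there and its kernel has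
  index at most 2.\<close>

lemma isotropic_half:
  fixes n :: nat
  assumes B: "biadditive B"
  defines "U \<equiv> {z \<in> bcube n. \<forall>x\<in>bcube n. B x z = B z x}"
  shows "subgroup2 {z \<in> U. B z z = 0}" "card U \<le> 2 * card {z \<in> U. B z z = 0}"
proof -
  let ?U0 = "{z \<in> U. B z z = 0}"
  note Bs = biadditive_simps[OF B]
  have sym: "B x z = B z x" if "z \<in> U" "x \<in> bcube n" for x z using that unfolding U_def by blast
  have UV: "z \<in> bcube n" if "z \<in> U" for z using that unfolding U_def by blast
  have UU: "x + y \<in> U" if "x \<in> U" "y \<in> U" for x y
    unfolding U_def mem_Collect_eq
  proof (intro conjI ballI)
    show "x + y \<in> bcube n" using UV that by simp
    fix z assume "z \<in> bcube n"
    then show "B z (x + y) = B (x + y) z" by (simp only: Bs sym[OF that(1)] sym[OF that(2)])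
  qed
  have diag: "B (x + y) (x + y) = B x x + B y y" if "x \<in> U" "y \<in> U" for x y
    using sym[OF that(1) UV[OF that(2)]] by (simp add: Bs add_ac)
  have U0: "0 \<in> U" by (simp add: U_def Bs)
  show "subgroup2 ?U0"
    using UU diag U0 by (auto simp: subgroup2_def Bs)
  have finU: "finite U" by (simp add: U_def)
  show "card U \<le> 2 * card ?U0"
  proof (cases "U = ?U0")
    case True
    then show ?thesis by simp
  next
    case False
    then obtain t where "t \<in> U" "B t t \<noteq> 0" by blast
    then have t: "t \<in> U" "B t t = 1" by simp_all
    have "U \<subseteq> ?U0 \<union> (\<lambda>z. t + z) ` ?U0"
    proof
      fix z assume z: "z \<in> U"
      show "z \<in> ?U0 \<union> (\<lambda>z. t + z) ` ?U0"
      proof (cases "B z z = 0")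
        case False
        then have "t + z \<in> ?U0" using z t UU diag by auto
        then have "t + (t + z) \<in> (\<lambda>z. t + z) ` ?U0" by (rule imageI)
        then show ?thesis by simp
      qed (use z in auto)
    qed
    then have "card U \<le> card (?U0 \<union> (\<lambda>z. t + z) ` ?U0)" using finU by (intro card_mono) auto
    also have "\<dots> \<le> card ?U0 + card ((\<lambda>z. t + z) ` ?U0)" by (rule card_Un_le)
    also have "\<dots> \<le> 2 * card ?U0" using card_image_le[of ?U0 "\<lambda>z. t + z"] finU by simp
    finally show ?thesis .
  qed
qed

section \<open>Quadratic functions over F_2\<close>

lemma bcube_SucE:
  assumes "x \<in> bcube (Suc m)"
  obtains "x \<in> bcube m" | t where "t \<in> bcube m" "x = t + unit_bvec m"
proof (cases "x m")
  case zero
  then have "x i = 0" if "m \<le> i" for i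
    using assms that by (cases "i = m") (auto simp: bcube_def)
  then have "x \<in> bcube m" by (simp add: bcube_def)
  then show ?thesis by (rule that(1))
next
  case one
  have "x + unit_bvec m \<in> bcube m"
    using assms one by (auto simp: bcube_def unit_bvec_def)
  moreover have "x = (x + unit_bvec m) + unit_bvec m" by (simp add: add.assoc)
  ultimately show ?thesis by (rule that(2))
qed

text \<open>Vanishing of the third difference at the base point 0; it characterises the polynomials of degree
  at most two and is visibly stable under sums and affine substitutions.\<close>

definition third_diff_zero :: "nat \<Rightarrow> ((nat \<Rightarrow> bit) \<Rightarrow> bit) \<Rightarrow> bool" where
  "third_diff_zero n q \<longleftrightarrow> (\<forall>x\<in>bcube n. \<forall>y\<in>bcube n. \<forall>z\<in>bcube n.
    q (x + y + z) = q (x + y) + q (y + z) + q (x + z) + q x + q y + q z + q 0)"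

text \<open>As halving is impossible, \<open>q\<close> is the strictly triangular half of
  \<open>B\<close>, built up one coordinate at a time.\<close>

lemma quadratic_form_of_alternating:
  assumes B: "biadditive B" and alt: "\<And>x. B x x = 0"
  shows "\<exists>q. \<forall>x\<in>bcube m. \<forall>y\<in>bcube m. q (x + y) = q x + q y + B x y"
proof (induction m)
  case 0
  have "B x y = 0" if "x \<in> bcube 0" for x y
  proof -
    have "x = 0" using that by (auto simp: bcube_def)
    then show ?thesis by (simp only: biadditive_simps(3)[OF B])
  qed
  then show ?case by (intro exI[of _ "\<lambda>_. 0"]) simp
next
  case (Suc m)
  note Bs = biadditive_simps[OF B]
  then obtain q where q: "\<And>x y. x \<in> bcube m \<Longrightarrow> y \<in> bcube m \<Longrightarrow> q (x + y) = q x + q y + B x y"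
    using Suc by blast
  have sym: "B x y = B y x" for x y
  proof -
    have "B x y + B y x = 0" using alt[of "x + y"] unfolding Bs by (simp add: alt add.commute)
    then show ?thesis by (cases "B x y"; cases "B y x") auto
  qed
  let ?e = "unit_bvec m"
  \<comment> \<open>Each \<open>x\<close> is split as \<open>t x + s x\<close>, with
    \<open>s x\<close> either 0 or the last unit vector. \<open>B\<close> vanishes on the line of
    that vector, so the new coordinate adds only the cross term, counted once.\<close>
  define t where "t = (\<lambda>x::nat \<Rightarrow> bit. if x m = 0 then x else x + ?e)"
  define s where "s = (\<lambda>x::nat \<Rightarrow> bit. if x m = 0 then 0 else ?e)"
  define q' where "q' = (\<lambda>x. q (t x) + B (s x) (t x))"
  have em: "?e m = 1" by (simp add: unit_bvec_def)
  have ts: "t x + s x = x" for x by (simp add: t_def s_def add.assoc)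
  have tadd: "t (x + y) = t x + t y" and sadd: "s (x + y) = s x + s y" for x y
    by (cases "x m"; cases "y m"; simp add: t_def s_def add_ac)+
  have tin: "t x \<in> bcube m" if "x \<in> bcube (Suc m)" for x
    using that unfolding t_def
    by (cases rule: bcube_SucE) (auto simp: em add.assoc bcube_def)
  have Bss: "B (s x) (s y) = 0" for x y by (simp add: s_def alt Bs)
  have "q' (x + y) = q' x + q' y + B x y" if "x \<in> bcube (Suc m)" "y \<in> bcube (Suc m)" for x y
  proof -
    have "B x y = B (t x + s x) (t y + s y)" by (simp add: ts)
    also have "\<dots> = B (t x) (t y) + B (s y) (t x) + B (s x) (t y)"
      by (simp add: Bs Bss sym[of "t x" "s y"] add_ac)
    finally have "B x y = B (t x) (t y) + B (s y) (t x) + B (s x) (t y)" .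
    then show ?thesis
      by (simp add: q'_def tadd sadd q tin that Bs add_ac)
  qed
  then show ?case by blast
qed

lemma third_diff_zero_add:
  "third_diff_zero n p \<Longrightarrow> third_diff_zero n q \<Longrightarrow> third_diff_zero n (\<lambda>x. p x + q x)"
  unfolding third_diff_zero_def by (simp add: add_ac)

lemma third_diff_zero_additive:
  assumes "\<And>x y. x \<in> bcube n \<Longrightarrow> y \<in> bcube n \<Longrightarrow> l (x + y) = l x + l y"
  shows "third_diff_zero n l"
proof -
  have "l 0 = 0" using assms[of 0 0] by simp
  then show ?thesis unfolding third_diff_zero_def by (simp add: assms add_ac)
qed

lemma third_diff_zero_const: "third_diff_zero n (\<lambda>_. c)"
  by (simp add: third_diff_zero_def)

lemma third_diff_zero_quadratic:
  assumes B: "biadditive B" and q: "\<And>x y. x \<in> bcube n \<Longrightarrow> y \<in> bcube n \<Longrightarrow> q (x + y) = q x + q y + B x y"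
  shows "third_diff_zero n q"
proof -
  have "q 0 = 0" using q[of 0 0] by (simp add: biadditive_simps[OF B])
  then show ?thesis unfolding third_diff_zero_def by (simp add: q biadditive_simps[OF B] add_ac)
qed

text \<open>For the shift by \<open>k\<close>, the third difference at base point \<open>k\<close>
  is a sum of third differences at 0; five instances, four of them with \<open>k\<close> as a
  direction, suffice.\<close>

lemma third_diff_zero_affine:
  assumes q: "third_diff_zero n q" and k: "k \<in> bcube n"
    and P: "\<And>x y. P (x + y) = P x + P y" "\<And>x. x \<in> bcube n \<Longrightarrow> P x \<in> bcube n"
  shows "third_diff_zero n (\<lambda>x. q (k + P x))"
proof -
  have P0: "P 0 = 0" using P(1)[of 0 0] by simp
  have t: "q (x + y + z) = q (x + y) + q (y + z) + q (x + z) + q x + q y + q z + q 0"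
    if "x \<in> bcube n" "y \<in> bcube n" "z \<in> bcube n" for x y z
    using q that by (simp add: third_diff_zero_def)
  have "q (k + (x + y + z)) = q (k + (x + y)) + q (k + (y + z)) + q (k + (x + z)) + q (k + x) + q (k + y)
      + q (k + z) + q (k + 0)" if "x \<in> bcube n" "y \<in> bcube n" "z \<in> bcube n" for x y z
    using t[of k "x + y" z] t[of k x y] t[of k y z] t[of k x z] t[of x y z] that k
    by (simp add: add_ac)
  then show ?thesis using P(2) by (simp add: third_diff_zero_def P(1) P0)
qed

lemma affine_bit_function:
  assumes "\<And>x y. x \<in> bcube m \<Longrightarrow> y \<in> bcube m \<Longrightarrow> l (x + y) = l x + l y + d"
    and "l 0 = d" and "x \<in> bcube m"
  shows "l x = d + (\<Sum>i<m. (l (unit_bvec i) + d) * x i)"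
  using assms
proof (induction m arbitrary: x)
  case 0
  then have "x = 0" by (auto simp: bcube_def)
  then show ?case using \<open>l 0 = d\<close> by (simp only: lessThan_0 sum.empty add_0_right)
next
  case (Suc m)
  have sub: "y \<in> bcube (Suc m)" if "y \<in> bcube m" for y using that by (simp add: bcube_def)
  have IH: "l y = d + (\<Sum>i<m. (l (unit_bvec i) + d) * y i)" if "y \<in> bcube m" for y
    using Suc.IH[OF Suc.prems(1,2) that] sub by blast
  from Suc.prems(3) show ?case
  proof (cases rule: bcube_SucE)
    case 1
    then have "x m = 0" by (simp add: bcube_def)
    then show ?thesis using IH[OF 1] by simp
  next
    case (2 t)
    have tm: "t m = 0" using 2(1) by (simp add: bcube_def)
    have xm: "x m = 1" and xi: "i < m \<Longrightarrow> x i = t i" for i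
      by (simp_all add: 2(2) tm unit_bvec_def)
    have "l x = l t + l (unit_bvec m) + d" unfolding 2(2) by (rule Suc.prems(1)[OF sub[OF 2(1)]]) simp
    then show ?thesis using IH[OF 2(1)] xm xi by (simp add: add_ac)
  qed
qed

text \<open>The last variable is peeled off: the derivative \<open>l\<close> of \<open>q\<close>
  along \<open>unit_bvec m\<close> is affine because the third difference vanishes, and q (t +
  unit_bvec m) = q t + l t.\<close>

lemma quadratic_bit_function:
  assumes q: "third_diff_zero n q" and "m \<le> n"
  shows "\<exists>b a. \<forall>x\<in>bcube m. q x = q 0 + (\<Sum>i<m. b i * x i) + (\<Sum>i<m. \<Sum>j<m. a i j * (x i * x j))"
  using \<open>m \<le> n\<close>
proof (induction m)
  case 0
  have "x = 0" if "x \<in> bcube 0" for x using that by (auto simp: bcube_def)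
  then show ?case by (auto simp only: lessThan_0 sum.empty add_0_right)
next
  case (Suc m)
  then obtain b a where ba: "\<And>x. x \<in> bcube m \<Longrightarrow>
      q x = q 0 + (\<Sum>i<m. b i * x i) + (\<Sum>i<m. \<Sum>j<m. a i j * (x i * x j))" by auto
  have sub: "y \<in> bcube n" if "y \<in> bcube m" for y
    using that Suc.prems by (simp add: bcube_def)
  have en: "unit_bvec m \<in> bcube n" using Suc.prems by simp
  define l where "l = (\<lambda>t. q (t + unit_bvec m) + q t)"
  have laff: "l (x + y) = l x + l y + l 0" if "x \<in> bcube m" "y \<in> bcube m" for x y
  proof -
    have "q (x + y + unit_bvec m) = q (x + y) + q (y + unit_bvec m) + q (x + unit_bvec m)
        + q x + q y + q (unit_bvec m) + q 0"
      using q en sub[OF that(1)] sub[OF that(2)] unfolding third_diff_zero_def by blast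
    then show ?thesis by (simp add: l_def add_ac)
  qed
  define \<beta> where "\<beta> = (\<lambda>i. l (unit_bvec i) + l 0)"
  have l: "l t = l 0 + (\<Sum>i<m. \<beta> i * t i)" if "t \<in> bcube m" for t
    unfolding \<beta>_def by (rule affine_bit_function[OF laff refl that])
  \<comment> \<open>The constant part of \<open>l\<close> becomes the new linear coefficient. Its
    linear part fills column \<open>m\<close> of \<open>a'\<close> above the diagonal; row
    \<open>m\<close> stays zero so that no mixed term is counted twice.\<close>
  define b' where "b' = b(m := l 0)"
  define a' where "a' = (\<lambda>i j. if j = m then (if i = m then 0 else \<beta> i) else if i = m then 0 else a i j)"
  have "q x = q 0 + (\<Sum>i<Suc m. b' i * x i) + (\<Sum>i<Suc m. \<Sum>j<Suc m. a' i j * (x i * x j))"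
    if "x \<in> bcube (Suc m)" for x
  proof -
    have s1: "(\<Sum>i<Suc m. b' i * x i) = (\<Sum>i<m. b i * x i) + l 0 * x m"
      by (simp add: b'_def)
    have s2: "(\<Sum>i<Suc m. \<Sum>j<Suc m. a' i j * (x i * x j))
        = (\<Sum>i<m. \<Sum>j<m. a i j * (x i * x j)) + (\<Sum>i<m. \<beta> i * x i) * x m"
      by (simp add: a'_def sum.distrib sum_distrib_right mult.assoc)
    from that show ?thesis
    proof (cases rule: bcube_SucE)
      case 1
      then have "x m = 0" by (simp add: bcube_def)
      then show ?thesis using ba[OF 1] s1 s2 by simp
    next
      case (2 t)
      have tm: "t m = 0" using 2(1) by (simp add: bcube_def)
      have xm: "x m = 1" and xi: "i < m \<Longrightarrow> x i = t i" for i
        by (simp_all add: 2(2) tm unit_bvec_def)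
      have "q x = q t + l t" by (simp add: l_def 2(2))
      then show ?thesis unfolding s1 s2 using ba[OF 2(1)] l[OF 2(1)] xm xi by (simp add: add_ac)
    qed
  qed
  then show ?case by blast
qed

section \<open>From a spectral graph to correlation with a quadratic phase\<close>

lemma sum_pigeonhole:
  fixes g :: "'a \<Rightarrow> real" and c :: real
  assumes "finite A" "A \<noteq> {}" "c * card A \<le> (\<Sum>x\<in>A. g x)"
  shows "\<exists>x\<in>A. c \<le> g x"
proof (rule ccontr)
  assume "\<not> ?thesis"
  then have "(\<Sum>x\<in>A. g x) < (\<Sum>x\<in>A. c)" using assms(1,2) by (intro sum_strict_mono) (auto simp: not_le)
  then show False using assms(3) by (simp add: mult.commute)
qed

text \<open>In the Fourier expression of \<open>ft_triple\<close> the largest value of |ft n f a| is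
  taken out; Cauchy--Schwarz and Parseval bound what remains, as \<open>g\<close> and
  \<open>h\<close> are unimodular.\<close>

lemma ft_triple_large:
  fixes f g h :: "(nat \<Rightarrow> bit) \<Rightarrow> real"
  assumes g: "\<And>x. x \<in> bcube n \<Longrightarrow> \<bar>g x\<bar> = 1" and h: "\<And>x. x \<in> bcube n \<Longrightarrow> \<bar>h x\<bar> = 1"
    and big: "c * (2 ^ n) ^ 2 \<le> \<bar>\<Sum>x\<in>bcube n. \<Sum>y\<in>bcube n. f x * g y * h (x + y)\<bar>"
  shows "\<exists>a\<in>bcube n. c * 2 ^ n \<le> \<bar>ft n f a\<bar>"
proof -
  let ?V = "bcube n"
  define R where "R = Max ((\<lambda>a. \<bar>ft n f a\<bar>) ` ?V)"
  have fin: "finite ((\<lambda>a. \<bar>ft n f a\<bar>) ` ?V)" by simp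
  have R: "\<bar>ft n f a\<bar> \<le> R" if "a \<in> ?V" for a unfolding R_def using that by (intro Max_ge) auto
  have "R \<in> (\<lambda>a. \<bar>ft n f a\<bar>) ` ?V" unfolding R_def by (rule Max_in) auto
  then obtain a where a: "a \<in> ?V" "R = \<bar>ft n f a\<bar>" by auto
  have R0: "R \<ge> 0" using a by simp
  have sq: "(\<Sum>a\<in>?V. \<bar>ft n g a\<bar> ^ 2) = (2 ^ n) ^ 2" if "\<And>x. x \<in> bcube n \<Longrightarrow> \<bar>g x\<bar> = 1" for g
  proof -
    have "g x * g x = 1" if "x \<in> ?V" for x using \<open>\<And>x. x \<in> ?V \<Longrightarrow> \<bar>g x\<bar> = 1\<close>[OF that]
      by (metis abs_mult_self_eq mult_1)
    then show ?thesis using ft_Parseval[of n g g] by (simp add: power2_eq_square)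
  qed
  have "(\<Sum>a\<in>?V. \<bar>ft n g a\<bar> * \<bar>ft n h a\<bar>) ^ 2 \<le> ((2 ^ n) ^ 2) ^ 2"
    using Cauchy_Schwarz_ineq_sum[of "\<lambda>a. \<bar>ft n g a\<bar>" "\<lambda>a. \<bar>ft n h a\<bar>" ?V] sq[OF g] sq[OF h]
    by (simp add: power2_eq_square)
  then have gh: "(\<Sum>a\<in>?V. \<bar>ft n g a\<bar> * \<bar>ft n h a\<bar>) \<le> (2 ^ n) ^ 2" by (rule power2_le_imp_le) simp
  have "2 ^ n * (c * (2 ^ n) ^ 2) \<le> 2 ^ n * \<bar>\<Sum>x\<in>bcube n. \<Sum>y\<in>bcube n. f x * g y * h (x + y)\<bar>"
    using big by (intro mult_left_mono) auto
  also have "\<dots> = \<bar>\<Sum>a\<in>?V. ft n f a * ft n g a * ft n h a\<bar>" by (simp add: ft_triple abs_mult)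
  also have "\<dots> \<le> (\<Sum>a\<in>?V. \<bar>ft n f a * ft n g a * ft n h a\<bar>)" by (rule sum_abs)
  also have "\<dots> \<le> (\<Sum>a\<in>?V. R * (\<bar>ft n g a\<bar> * \<bar>ft n h a\<bar>))"
    unfolding abs_mult mult.assoc by (intro sum_mono mult_right_mono R) auto
  also have "\<dots> = R * (\<Sum>a\<in>?V. \<bar>ft n g a\<bar> * \<bar>ft n h a\<bar>)" by (simp add: sum_distrib_left)
  also have "\<dots> \<le> R * (2 ^ n) ^ 2" by (rule mult_left_mono[OF gh R0])
  finally have "(2 ^ n) ^ 2 * (c * 2 ^ n) \<le> (2 ^ n) ^ 2 * R" by (simp add: power2_eq_square mult_ac)
  then have "c * 2 ^ n \<le> R" by simp
  then show ?thesis using a by auto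
qed

text \<open>The argument finds correlation \<eta> with a quadratic phase on one coset of
  \<open>U\<close>. Passing to the whole cube without renormalising loses the density of
  \<open>U\<close>, which is why the bound reads \<eta> |U|.\<close>

lemma correlation_on_isotropic_subgroup:
  assumes f: "\<And>x. x \<in> bcube n \<Longrightarrow> \<bar>f x\<bar> = 1" and B: "biadditive B"
    and big: "\<eta> * (2 ^ n) ^ 3 \<le> (\<Sum>y\<in>bcube n. \<Sum>h\<in>bcube n. box_corr n f y h * chi (B y h + dot n w h))"
    and U: "subgroup2 U" "U \<subseteq> bcube n" "\<And>u. u \<in> U \<Longrightarrow> B u u = 0"
  shows "\<exists>q. third_diff_zero n q \<and> \<eta> * card U \<le> \<bar>\<Sum>x\<in>bcube n. f x * chi (q x)\<bar>"
proof -
  let ?V = "bcube n" and ?N = "2 ^ n :: real"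
  note Bs = biadditive_simps[OF B]
  obtain P where P: "\<And>x y. P (x + y) = P x + P y" "range P \<subseteq> U" "\<And>u. u \<in> U \<Longrightarrow> P u = u"
    using additive_projection[OF U(1)] by blast
  have PU: "P x \<in> U" for x using P(2) by blast
  have PV: "P x \<in> ?V" for x using PU U(2) by blast
  have PP: "P (P x) = P x" for x using PU P(3) by blast
  have finU: "finite U" using U(2) finite_subset bcube_card(1) by blast
  have B': "biadditive (\<lambda>x y. B (P x) (P y))" by (simp add: biadditive_def P(1) Bs)
  obtain q0 where q0: "\<And>x y. x \<in> ?V \<Longrightarrow> y \<in> ?V \<Longrightarrow> q0 (x + y) = q0 x + q0 y + B (P x) (P y)"
    using quadratic_form_of_alternating[OF B', of n] U(3) PU by blast
  define \<Psi> where "\<Psi> = (\<lambda>x y h. f x * f (x + y) * f (x + h) * f (x + y + h) * chi (B y h + dot n w h))"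
  define \<Phi> where "\<Phi> = (\<lambda>y h. \<Sum>x\<in>?V. \<Psi> x y h)"
  have big: "\<eta> * ?N ^ 3 \<le> (\<Sum>y\<in>?V. \<Sum>h\<in>?V. \<Phi> y h)"
    using big by (simp add: box_corr_def \<Psi>_def \<Phi>_def sum_distrib_right)
  \<comment> \<open>Both directions are averaged over cosets of \<open>U\<close>. The points of
    \<open>U\<close> are written \<open>P v\<close> with \<open>v\<close> in the whole cube, so that
    no Fourier analysis on \<open>U\<close> itself is required.\<close>
  have "\<exists>r\<in>?V \<times> ?V. \<eta> * ?N ^ 3 \<le> (\<Sum>v\<in>?V. \<Sum>v'\<in>?V. \<Phi> (fst r + P v) (snd r + P v'))"
  proof (rule sum_pigeonhole)
    have "(\<Sum>r\<in>?V \<times> ?V. \<Sum>v\<in>?V. \<Sum>v'\<in>?V. \<Phi> (fst r + P v) (snd r + P v'))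
        = (\<Sum>v\<in>?V. \<Sum>r\<in>?V \<times> ?V. \<Sum>v'\<in>?V. \<Phi> (fst r + P v) (snd r + P v'))" by (rule sum.swap)
    also have "\<dots> = (\<Sum>v\<in>?V. \<Sum>v'\<in>?V. \<Sum>r\<in>?V \<times> ?V. \<Phi> (fst r + P v) (snd r + P v'))"
      by (intro sum.cong refl sum.swap)
    also have "\<dots> = (\<Sum>v\<in>?V. \<Sum>v'\<in>?V. \<Sum>t\<in>?V. \<Sum>s\<in>?V. \<Phi> (t + P v) (s + P v'))"
      by (simp add: sum.cartesian_product')
    also have "\<dots> = (\<Sum>v\<in>?V. \<Sum>v'\<in>?V. \<Sum>t\<in>?V. \<Sum>s\<in>?V. \<Phi> (t + P v) s)"
      by (intro sum.cong refl sum_translate PV)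
    also have "\<dots> = (\<Sum>v\<in>?V. \<Sum>v'\<in>?V. \<Sum>t\<in>?V. \<Sum>s\<in>?V. \<Phi> t s)"
      by (intro sum.cong refl sum_translate[where g = "\<lambda>t. \<Sum>s\<in>?V. \<Phi> t s"] PV)
    also have "\<dots> = ?N ^ 2 * (\<Sum>t\<in>?V. \<Sum>s\<in>?V. \<Phi> t s)" by (simp add: power2_eq_square)
    finally show "\<eta> * ?N ^ 3 * card (?V \<times> ?V)
        \<le> (\<Sum>r\<in>?V \<times> ?V. \<Sum>v\<in>?V. \<Sum>v'\<in>?V. \<Phi> (fst r + P v) (snd r + P v'))"
      using mult_left_mono[OF big, of "?N ^ 2"]
      by (simp add: card_cartesian_product power2_eq_square mult_ac)
  qed auto
  then obtain t s where ts: "t \<in> ?V" "s \<in> ?V"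
      "\<eta> * ?N ^ 3 \<le> (\<Sum>v\<in>?V. \<Sum>v'\<in>?V. \<Phi> (t + P v) (s + P v'))" by auto
  have "\<exists>x\<in>?V. \<eta> * ?N ^ 2 \<le> (\<Sum>v\<in>?V. \<Sum>v'\<in>?V. \<Psi> x (t + P v) (s + P v'))"
  proof (rule sum_pigeonhole)
    have "(\<Sum>v\<in>?V. \<Sum>v'\<in>?V. \<Phi> (t + P v) (s + P v'))
        = (\<Sum>v\<in>?V. \<Sum>x\<in>?V. \<Sum>v'\<in>?V. \<Psi> x (t + P v) (s + P v'))"
      unfolding \<Phi>_def by (intro sum.cong refl sum.swap)
    also have "\<dots> = (\<Sum>x\<in>?V. \<Sum>v\<in>?V. \<Sum>v'\<in>?V. \<Psi> x (t + P v) (s + P v'))" by (rule sum.swap)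
    finally show "\<eta> * ?N ^ 2 * card ?V \<le> (\<Sum>x\<in>?V. \<Sum>v\<in>?V. \<Sum>v'\<in>?V. \<Psi> x (t + P v) (s + P v'))"
      using ts(3) by (simp add: eval_nat_numeral mult_ac)
  qed auto
  then obtain x where x: "x \<in> ?V" "\<eta> * ?N ^ 2 \<le> (\<Sum>v\<in>?V. \<Sum>v'\<in>?V. \<Psi> x (t + P v) (s + P v'))" by blast
  \<comment> \<open>Since B (P v) (P v') = q0 v + q0 v' + q0 (v + v'), the mixed phase is
    distributed over functions of \<open>v\<close>, of \<open>v'\<close> and of v + v', the shape
    required by \<open>ft_triple_large\<close>.\<close>
  define f1 where "f1 = (\<lambda>v. f (x + t + P v) * chi (B (P v) s + q0 v))"
  define f2 where "f2 = (\<lambda>v. f (x + s + P v) * chi (B t (P v) + dot n w (P v) + q0 v))"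
  define f3 where "f3 = (\<lambda>v. f (x + t + s + P v) * chi (q0 v))"
  define \<kappa> where "\<kappa> = f x * chi (B t s + dot n w s)"
  have \<Psi>_eq: "\<Psi> x (t + P v) (s + P v') = \<kappa> * (f1 v * f2 v' * f3 (v + v'))" if "v \<in> ?V" "v' \<in> ?V" for v v'
  proof -
    have "chi (B (t + P v) (s + P v') + dot n w (s + P v')) = chi (B t s + dot n w s)
        * chi (B (P v) s + q0 v) * chi (B t (P v') + dot n w (P v') + q0 v') * chi (q0 (v + v'))"
      unfolding q0[OF that] chi_add[symmetric] by (simp add: Bs dot_add_right add_ac)
    moreover have "x + (t + P v) + (s + P v') = x + t + s + P (v + v')"
      "x + (t + P v) = x + t + P v" "x + (s + P v') = x + s + P v'"
      by (simp_all add: P(1) add_ac)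
    ultimately show ?thesis unfolding \<Psi>_def \<kappa>_def f1_def f2_def f3_def by (simp only: mult_ac)
  qed
  have \<kappa>: "\<bar>\<kappa>\<bar> = 1" using f x(1) by (simp add: \<kappa>_def abs_mult)
  have "\<eta> * ?N ^ 2 \<le> \<kappa> * (\<Sum>v\<in>?V. \<Sum>v'\<in>?V. f1 v * f2 v' * f3 (v + v'))"
    using x(2) by (simp add: \<Psi>_eq sum_distrib_left)
  also have "\<dots> \<le> \<bar>\<kappa> * (\<Sum>v\<in>?V. \<Sum>v'\<in>?V. f1 v * f2 v' * f3 (v + v'))\<bar>" by simp
  also have "\<dots> = \<bar>\<Sum>v\<in>?V. \<Sum>v'\<in>?V. f1 v * f2 v' * f3 (v + v')\<bar>" by (simp only: abs_mult \<kappa> mult_1)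
  finally have "\<eta> * ?N ^ 2 \<le> \<bar>\<Sum>v\<in>?V. \<Sum>v'\<in>?V. f1 v * f2 v' * f3 (v + v')\<bar>" .
  moreover have "\<bar>f2 v\<bar> = 1" "\<bar>f3 v\<bar> = 1" if "v \<in> ?V" for v
    using f x(1) ts PV by (simp_all add: f2_def f3_def abs_mult)
  ultimately obtain \<gamma> where \<gamma>: "\<gamma> \<in> ?V" "\<eta> * ?N \<le> \<bar>ft n f1 \<gamma>\<bar>"
    using ft_triple_large[of n f2 f3 \<eta> f1] by blast
  define q1 where "q1 = (\<lambda>v. B (P v) s + q0 v + dot n \<gamma> v)"
  have q1: "third_diff_zero n q1" unfolding q1_def
    by (intro third_diff_zero_add third_diff_zero_additive third_diff_zero_quadratic[OF B'] q0)
      (simp_all add: P(1) Bs dot_add_right)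
  define \<phi> where "\<phi> = (\<lambda>v. f (x + t + P v) * chi (q1 v))"
  have \<phi>: "\<eta> * ?N \<le> \<bar>\<Sum>v\<in>?V. \<phi> v\<bar>"
    using \<gamma>(2) by (simp add: ft_def f1_def \<phi>_def q1_def chi_add mult_ac)
  \<comment> \<open>In \<phi> the function \<open>f\<close> sees only \<open>P v\<close>, whereas
    \<open>q1\<close> sees all of \<open>v\<close>. Averaging over the translates
    \<open>k + P z\<close> makes both depend on \<open>P z\<close> alone, up to constants.\<close>
  have "\<exists>k\<in>?V. \<eta> * ?N \<le> \<bar>\<Sum>z\<in>?V. \<phi> (k + P z)\<bar>"
  proof (rule sum_pigeonhole)
    have "(\<Sum>k\<in>?V. \<Sum>z\<in>?V. \<phi> (k + P z)) = (\<Sum>z\<in>?V. \<Sum>k\<in>?V. \<phi> (k + P z))" by (rule sum.swap)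
    also have "\<dots> = (\<Sum>z\<in>?V. \<Sum>k\<in>?V. \<phi> k)" by (intro sum.cong refl sum_translate PV)
    also have "\<dots> = ?N * (\<Sum>k\<in>?V. \<phi> k)" by simp
    finally have "?N * \<bar>\<Sum>k\<in>?V. \<phi> k\<bar> = \<bar>\<Sum>k\<in>?V. \<Sum>z\<in>?V. \<phi> (k + P z)\<bar>" by (simp add: abs_mult)
    also have "\<dots> \<le> (\<Sum>k\<in>?V. \<bar>\<Sum>z\<in>?V. \<phi> (k + P z)\<bar>)" by (rule sum_abs)
    finally have "?N * \<bar>\<Sum>k\<in>?V. \<phi> k\<bar> \<le> (\<Sum>k\<in>?V. \<bar>\<Sum>z\<in>?V. \<phi> (k + P z)\<bar>)" .
    moreover have "?N * (\<eta> * ?N) \<le> ?N * \<bar>\<Sum>k\<in>?V. \<phi> k\<bar>" using \<phi> by (intro mult_left_mono) auto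
    ultimately have "?N * (\<eta> * ?N) \<le> (\<Sum>k\<in>?V. \<bar>\<Sum>z\<in>?V. \<phi> (k + P z)\<bar>)" by linarith
    then show "\<eta> * ?N * card ?V \<le> (\<Sum>k\<in>?V. \<bar>\<Sum>z\<in>?V. \<phi> (k + P z)\<bar>)" by (simp add: mult_ac)
  qed auto
  then obtain k where k: "k \<in> ?V" "\<eta> * ?N \<le> \<bar>\<Sum>z\<in>?V. \<phi> (k + P z)\<bar>" by blast
  define x1 where "x1 = x + t + P k"
  have x1: "x1 \<in> ?V" using x ts PV by (simp add: x1_def)
  define \<psi> where "\<psi> = (\<lambda>u. f (x1 + u) * chi (q1 (k + u)))"
  have "\<phi> (k + P z) = \<psi> (P z)" for z by (simp add: \<phi>_def \<psi>_def x1_def P(1) PP add_ac)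
  then have \<psi>: "\<eta> * ?N \<le> \<bar>\<Sum>z\<in>?V. \<psi> (P z)\<bar>" using k(2) by simp
  \<comment> \<open>\<open>P\<close> maps the cube onto \<open>U\<close> with fibres of equal size;
    the count is done by translating with the elements of \<open>U\<close>.\<close>
  have "card U * (\<Sum>z\<in>?V. \<psi> (P z)) = ?N * (\<Sum>u\<in>U. \<psi> u)"
  proof -
    have "card U * (\<Sum>z\<in>?V. \<psi> (P z)) = (\<Sum>u\<in>U. \<Sum>z\<in>?V. \<psi> (P z))" by simp
    also have "\<dots> = (\<Sum>u\<in>U. \<Sum>z\<in>?V. \<psi> (P (z + u)))"
      using U(2) by (intro sum.cong refl sum_translate[symmetric, where g = "\<lambda>z. \<psi> (P z)"]) auto
    also have "\<dots> = (\<Sum>z\<in>?V. \<Sum>u\<in>U. \<psi> (P (z + u)))" by (rule sum.swap)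
    also have "\<dots> = (\<Sum>z\<in>?V. \<Sum>u\<in>U. \<psi> (P z + u))" by (intro sum.cong refl) (simp add: P(1,3))
    also have "\<dots> = (\<Sum>z\<in>?V. \<Sum>u\<in>U. \<psi> u)"
    proof (rule sum.cong[OF refl])
      fix z
      show "(\<Sum>u\<in>U. \<psi> (P z + u)) = (\<Sum>u\<in>U. \<psi> u)"
        by (rule sum.reindex_bij_witness[of _ "\<lambda>u. P z + u" "\<lambda>u. P z + u"])
          (use U(1) PU in \<open>auto simp: subgroup2_def\<close>)
    qed
    finally show ?thesis by simp
  qed
  then have "\<bar>?N * (\<Sum>u\<in>U. \<psi> u)\<bar> = \<bar>card U * (\<Sum>z\<in>?V. \<psi> (P z))\<bar>" by simp
  then have "?N * \<bar>\<Sum>u\<in>U. \<psi> u\<bar> = card U * \<bar>\<Sum>z\<in>?V. \<psi> (P z)\<bar>" by (simp add: abs_mult)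
  also have "\<dots> \<ge> card U * (\<eta> * ?N)" using \<psi> by (intro mult_left_mono) auto
  finally have \<psi>U: "\<eta> * card U \<le> \<bar>\<Sum>u\<in>U. \<psi> u\<bar>" by (simp add: mult_ac)
  have "\<exists>v\<in>?V. \<eta> * card U \<le> \<bar>\<Sum>x\<in>?V. \<psi> x * chi (dot n v (x + P x))\<bar>"
  proof (rule sum_pigeonhole)
    have "(\<Sum>v\<in>?V. \<Sum>x\<in>?V. \<psi> x * chi (dot n v (x + P x)))
        = (\<Sum>x\<in>?V. \<Sum>v\<in>?V. \<psi> x * chi (dot n (x + P x) v))"
      by (subst sum.swap) (simp add: dot_commute)
    also have "\<dots> = (\<Sum>x\<in>?V. \<psi> x * (if x = P x then ?N else 0))"
      by (intro sum.cong refl) (simp add: sum_distrib_left[symmetric] sum_chi_dot PV)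
    also have "\<dots> = (\<Sum>x\<in>?V. if x \<in> U then ?N * \<psi> x else 0)"
      by (intro sum.cong refl) (metis P(3) PU mult.commute mult_zero_right)
    also have "\<dots> = ?N * (\<Sum>u\<in>U. \<psi> u)"
      using U(2) by (simp add: sum.If_cases Int_absorb1 sum_distrib_left)
    finally have "?N * \<bar>\<Sum>u\<in>U. \<psi> u\<bar> = \<bar>\<Sum>v\<in>?V. \<Sum>x\<in>?V. \<psi> x * chi (dot n v (x + P x))\<bar>"
      by (simp add: abs_mult)
    also have "\<dots> \<le> (\<Sum>v\<in>?V. \<bar>\<Sum>x\<in>?V. \<psi> x * chi (dot n v (x + P x))\<bar>)" by (rule sum_abs)
    finally have "?N * \<bar>\<Sum>u\<in>U. \<psi> u\<bar> \<le> (\<Sum>v\<in>?V. \<bar>\<Sum>x\<in>?V. \<psi> x * chi (dot n v (x + P x))\<bar>)" .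
    moreover have "?N * (\<eta> * card U) \<le> ?N * \<bar>\<Sum>u\<in>U. \<psi> u\<bar>" using \<psi>U by (intro mult_left_mono) auto
    ultimately have "?N * (\<eta> * card U) \<le> (\<Sum>v\<in>?V. \<bar>\<Sum>x\<in>?V. \<psi> x * chi (dot n v (x + P x))\<bar>)" by linarith
    then show "\<eta> * card U * card ?V \<le> (\<Sum>v\<in>?V. \<bar>\<Sum>x\<in>?V. \<psi> x * chi (dot n v (x + P x))\<bar>)"
      by (simp add: mult_ac)
  qed auto
  then obtain v where v: "v \<in> ?V" "\<eta> * card U \<le> \<bar>\<Sum>x\<in>?V. \<psi> x * chi (dot n v (x + P x))\<bar>" by blast
  \<comment> \<open>The substitution x = x1 + y moves the coset back, so that \<open>f\<close> is
    evaluated at \<open>y\<close> itself; all shifts go into the phase.\<close>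
  define q2 where "q2 = (\<lambda>y. q1 (k + x1 + y) + (dot n v (x1 + P x1) + dot n v (y + P y)))"
  have "third_diff_zero n q2" unfolding q2_def
    by (intro third_diff_zero_add third_diff_zero_const third_diff_zero_additive
        third_diff_zero_affine[OF q1, where P = "\<lambda>x. x"])
      (simp_all add: k x1 P(1) dot_add_right add_ac)
  moreover have "(\<Sum>x\<in>?V. \<psi> x * chi (dot n v (x + P x))) = (\<Sum>y\<in>?V. f y * chi (q2 y))"
  proof -
    have "(\<Sum>x\<in>?V. \<psi> x * chi (dot n v (x + P x)))
        = (\<Sum>y\<in>?V. \<psi> (x1 + y) * chi (dot n v (x1 + y + P (x1 + y))))"
      by (rule sum_translate'[OF x1, symmetric])
    also have "\<dots> = (\<Sum>y\<in>?V. f y * chi (q2 y))"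
      by (intro sum.cong refl) (simp add: \<psi>_def q2_def P(1) dot_add_right chi_add add_ac mult_ac)
    finally show ?thesis .
  qed
  ultimately show ?thesis using v(2) by (intro exI[of _ q2]) simp
qed

text \<open>Expanding \<open>dspec\<close> on the graph by \<open>dspec_eq_ft_box_corr\<close> gives
  a box sum with phase \<open>B y h + dot n w h\<close>. Its size \<eta> is used twice: squared and
  halved it bounds the density of the isotropic subgroup, and once more it is the correlation on
  that subgroup.\<close>

lemma correlation_of_affine_graph:
  assumes f: "\<And>x. x \<in> bcube n \<Longrightarrow> \<bar>f x\<bar> = 1" and \<eta>: "\<eta> \<ge> 0"
    and M: "\<And>x y. M (x + y) = M x + M y"
    and big: "\<eta> * 2 ^ n \<le> (\<Sum>y\<in>bcube n. dspec n f (y, M y + w))"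
  shows "\<exists>q. third_diff_zero n q \<and> \<eta> ^ 3 / 2 * 2 ^ n \<le> \<bar>\<Sum>x\<in>bcube n. f x * chi (q x)\<bar>"
proof -
  let ?N = "2 ^ n :: real"
  define B where "B = (\<lambda>x y. dot n (M x) y)"
  have B: "biadditive B" by (simp add: biadditive_def B_def M dot_add_left dot_add_right)
  have eq: "?N ^ 2 * (\<Sum>y\<in>bcube n. dspec n f (y, M y + w))
      = (\<Sum>y\<in>bcube n. \<Sum>h\<in>bcube n. box_corr n f y h * chi (B y h + dot n w h))"
    by (simp add: dspec_eq_ft_box_corr ft_def sum_divide_distrib[symmetric] B_def dot_add_left)
  have "\<eta> * ?N ^ 3 = ?N ^ 2 * (\<eta> * ?N)" by (simp add: eval_nat_numeral)
  also have "\<dots> \<le> ?N ^ 2 * (\<Sum>y\<in>bcube n. dspec n f (y, M y + w))"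
    using big by (intro mult_left_mono) auto
  finally have big': "\<eta> * ?N ^ 3 \<le> (\<Sum>y\<in>bcube n. \<Sum>h\<in>bcube n. box_corr n f y h * chi (B y h + dot n w h))"
    unfolding eq .
  define U where "U = {z \<in> {z \<in> bcube n. \<forall>x\<in>bcube n. B x z = B z x}. B z z = 0}"
  have U: "subgroup2 U" "\<eta> ^ 2 * ?N \<le> 2 * card U"
    using isotropic_half[OF B, of n] box_phase_symmetry[OF f B \<eta> big'] unfolding U_def by linarith+
  obtain q where q: "third_diff_zero n q" "\<eta> * card U \<le> \<bar>\<Sum>x\<in>bcube n. f x * chi (q x)\<bar>"
    using correlation_on_isotropic_subgroup[OF f B big' U(1)] unfolding U_def by blast
  have "\<eta> ^ 3 / 2 * ?N = \<eta> * (\<eta> ^ 2 * ?N / 2)" by (simp add: eval_nat_numeral)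
  also have "\<dots> \<le> \<eta> * card U" using U(2) \<eta> by (intro mult_left_mono) auto
  finally show ?thesis using q by (intro exI[of _ q]) linarith
qed

section \<open>Quantitative bounds\<close>

definition corr_bound :: "real \<Rightarrow> real" where
  "corr_bound u = (let \<delta> = u ^ 2 / 6; \<tau> = u ^ 2 / 2; c = \<tau> * \<delta> ^ 2; K = 4096 / c ^ 6;
     L = 2 powr (K ^ 4) * K / \<delta>; \<theta> = \<delta> * c * \<tau> / 4 in (\<theta> ^ 2 / L) ^ 3 / 2)"

lemma large_spectrum_quadratic_correlation:
  assumes f: "\<And>x. x \<in> bcube n \<Longrightarrow> \<bar>f x\<bar> = 1"
    and u: "u * 2 ^ n \<le> (\<Sum>p\<in>bcube2 n. dspec n f p ^ 2)" and u0: "0 < u" "u \<le> 1"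
  shows "\<exists>q. third_diff_zero n q \<and> corr_bound u * 2 ^ n \<le> \<bar>\<Sum>x\<in>bcube n. f x * chi (q x)\<bar>"
proof -
  define \<delta> \<tau> where "\<delta> = u ^ 2 / 6" and "\<tau> = u ^ 2 / 2"
  define c where "c = \<tau> * \<delta> ^ 2"
  define K where "K = 4096 / c ^ 6"
  define L \<theta> where "L = 2 powr (K ^ 4) * K / \<delta>" and "\<theta> = \<delta> * c * \<tau> / 4"
  define \<eta> where "\<eta> = \<theta> ^ 2 / L"
  have f2: "f x ^ 2 = 1" if "x \<in> bcube n" for x
    using f[OF that] by (metis power2_abs power_one)
  have pos: "\<delta> > 0" "\<tau> > 0" "c > 0" using u0 by (simp_all add: \<delta>_def \<tau>_def c_def)
  have pos': "K > 0" "L > 0" "\<theta> > 0" using pos by (simp_all add: K_def L_def \<theta>_def)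
  obtain H where H: "subgroup2 H" "H \<subseteq> bcube2 n" "real (card H) \<le> L * 2 ^ n"
      "\<theta> * 2 ^ n \<le> (\<Sum>p\<in>H. dspec n f p)"
    using spectrum_concentrates_on_subgroup[OF f2 u u0]
    unfolding \<delta>_def \<tau>_def c_def K_def L_def \<theta>_def by blast
  obtain M w where M: "\<And>x y. M (x + y) = M x + M y"
      "\<eta> * 2 ^ n \<le> (\<Sum>y\<in>bcube n. dspec n f (y, M y + w))"
    using spectrum_affine_graph[OF f2 H(1-3) pos'(3) H(4)] unfolding \<eta>_def by blast
  have \<eta>: "\<eta> \<ge> 0" using pos' by (simp add: \<eta>_def)
  have cb: "corr_bound u = \<eta> ^ 3 / 2"
    unfolding corr_bound_def Let_def \<eta>_def \<theta>_def L_def K_def c_def \<tau>_def \<delta>_def ..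
  show ?thesis unfolding cb by (rule correlation_of_affine_graph[OF f \<eta> M])
qed

text \<open>With p = 1 / u, all factors but E = 2^(K^4) are powers of \<open>p\<close> and
  constants, and K^4 is a constant times p^144. The logarithm of the reciprocal is thus at most a
  multiple of p^144, using ln p \<le> p^144.\<close>

lemma corr_bound_lower:
  "\<exists>D\<ge>0. \<forall>u. 0 < u \<longrightarrow> u \<le> 1 \<longrightarrow> exp (- D * (1 / u) ^ 144) \<le> corr_bound u / 2"
proof -
  define k where "k = (4096 * 72 ^ 6 :: real)"
  define A where "A = 3456 ^ 2 * 6 * k"
  have k0: "k \<ge> 1" unfolding k_def by simp
  have A0: "A \<ge> 1" unfolding A_def using mult_mono[of 1 "3456 ^ 2 * 6" 1 k] k0 by simp
  define D where "D = ln 4 + 3 * (ln A + 58 + k ^ 4 * ln 2)"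
  have "D \<ge> 0" unfolding D_def using k0 A0 by (intro add_nonneg_nonneg mult_nonneg_nonneg) auto
  moreover have "exp (- D * (1 / u) ^ 144) \<le> corr_bound u / 2" if u: "0 < u" "u \<le> 1" for u
  proof -
    define p where "p = 1 / u"
    have p1: "p \<ge> 1" and p0: "p > 0" and up: "u = 1 / p" using u by (simp_all add: p_def)
    define E where "E = 2 powr (k ^ 4 * p ^ 144)"
    have E0: "E > 0" by (simp add: E_def)
    have c: "u ^ 2 / 2 * (u ^ 2 / 6) ^ 2 = 1 / (72 * p ^ 6)"
      by (simp add: up power_divide flip: power_mult power_add)
    have K: "4096 / (1 / (72 * p ^ 6)) ^ 6 = k * p ^ 36"
      by (simp add: k_def power_mult_distrib power_divide flip: power_mult)
    have K4: "(k * p ^ 36) ^ 4 = k ^ 4 * p ^ 144"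
      by (simp add: power_mult_distrib flip: power_mult)
    have L: "E * (k * p ^ 36) / (u ^ 2 / 6) = 6 * k * E * p ^ 38"
      by (simp add: up power_divide flip: power_add)
    have \<theta>: "u ^ 2 / 6 * (1 / (72 * p ^ 6)) * (u ^ 2 / 2) / 4 = 1 / (3456 * p ^ 10)"
      by (simp add: up power_divide flip: power_add)
    \<comment> \<open>The exponent is 58 = 2 * 10 + 38, from \<theta>^2 and from
      \<open>L\<close>.\<close>
    have \<eta>: "(1 / (3456 * p ^ 10)) ^ 2 / (6 * k * E * p ^ 38) = 1 / (A * p ^ 58 * E)"
      by (simp add: A_def power_divide power_mult_distrib mult_ac flip: power_mult power_add)
    have cb: "corr_bound u / 2 = 1 / (4 * (A * p ^ 58 * E) ^ 3)"
      unfolding corr_bound_def Let_def c K K4 E_def[symmetric] L \<theta> \<eta> by (simp add: power_divide)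
    have pp: "1 \<le> p ^ 144" using p1 by simp
    have "ln p \<le> p" using ln_le_minus_one[OF p0] by simp
    also have "p \<le> p ^ 144" using power_increasing[of 1 144 p] p1 by simp
    finally have lnp: "ln p \<le> p ^ 144" .
    have lnA: "ln A \<le> ln A * p ^ 144" using A0 pp mult_left_mono[of 1 "p ^ 144" "ln A"] by simp
    have ln4: "ln 4 \<le> ln 4 * p ^ 144" using pp by simp
    have "ln (4 * (A * p ^ 58 * E) ^ 3) = ln 4 + 3 * (ln A + 58 * ln p + k ^ 4 * p ^ 144 * ln 2)"
      using A0 p0 E0 by (simp add: ln_mult ln_realpow E_def ln_powr)
    also have "\<dots> \<le> D * p ^ 144"
    proof -
      have D_eq: "D * p ^ 144 = ln 4 * p ^ 144 + 3 * (ln A * p ^ 144 + 58 * p ^ 144 + k ^ 4 * p ^ 144 * ln 2)"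
        by (simp add: D_def algebra_simps)
      have "a \<le> a' \<Longrightarrow> b \<le> b' \<Longrightarrow> c \<le> c' \<Longrightarrow> a + 3 * (b + 58 * c + d) \<le> a' + 3 * (b' + 58 * c' + d)"
        for a a' b b' c c' d :: real by (intro add_mono mult_left_mono) auto
      from this[OF ln4 lnA lnp] show ?thesis unfolding D_eq .
    qed
    finally have le: "ln (4 * (A * p ^ 58 * E) ^ 3) \<le> D * p ^ 144" .
    have pos: "4 * (A * p ^ 58 * E) ^ 3 > 0" using A0 p0 E0 by simp
    then have "4 * (A * p ^ 58 * E) ^ 3 \<le> exp (D * p ^ 144)"
      using le by (metis exp_le_cancel_iff exp_ln)
    then have "1 / exp (D * p ^ 144) \<le> corr_bound u / 2"
      unfolding cb using pos by (intro divide_left_mono) auto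
    then show ?thesis by (simp add: p_def exp_minus field_simps)
  qed
  ultimately show ?thesis by blast
qed

text \<open>Trades the factor \<open>D\<close> in the exponent for one extra power of
  \<open>p\<close> plus a constant; the constant turns into the prefactor \<open>c\<close> of the
  theorem.\<close>

lemma power_le_higher_power_plus:
  fixes D p :: real
  assumes "D \<ge> 0" "p \<ge> 0"
  shows "D * p ^ k \<le> p ^ Suc k + D ^ Suc k"
proof (cases "D \<le> p")
  case True
  then have "D * p ^ k \<le> p * p ^ k" using assms by (intro mult_right_mono) auto
  moreover have "D ^ Suc k \<ge> 0" using assms by simp
  ultimately show ?thesis by simp
next
  case False
  then have "D * p ^ k \<le> D * D ^ k" using assms by (intro mult_left_mono power_mono) auto
  moreover have "p ^ Suc k \<ge> 0" using assms by simp
  ultimately show ?thesis by simp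
qed

section \<open>Transfer to the Boolean cube and the Gowers norm\<close>

lemma of_nat_bit: "(of_nat k :: bit) = of_bool (odd k)"
  by (induction k) auto

lemma minus_one_power_eq_chi: "(- 1) ^ k = chi (of_nat k)"
  by (simp add: of_nat_bit chi_def)

lemma third_diff_zero_quad_poly_fun:
  assumes q: "third_diff_zero n q" and g: "\<And>x. x \<in> cube n \<Longrightarrow> g x = chi (q (\<lambda>i. of_bool (x i)))"
  shows "quad_poly_fun n g"
proof -
  obtain b a where ba: "\<And>x. x \<in> bcube n \<Longrightarrow>
      q x = q 0 + (\<Sum>i<n. b i * x i) + (\<Sum>i<n. \<Sum>j<n. a i j * (x i * x j))"
    using quadratic_bit_function[OF q order_refl] by blast
  have mult: "of_bool (d = 1 \<and> P) = d * of_bool P" "of_bool (P \<and> Q) = of_bool P * (of_bool Q :: bit)"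
    for d :: bit and P Q by (cases d; simp)+
  have one: "of_bool (d = 1) = d" for d :: bit by (cases d) simp_all
  show ?thesis unfolding quad_poly_fun_def
  proof (intro exI ballI)
    fix x assume x: "x \<in> cube n"
    let ?x = "\<lambda>i. of_bool (x i) :: bit"
    have "?x \<in> bcube n" using x by (simp add: cube_def bcube_def)
    then have "q ?x = q 0 + (\<Sum>i<n. b i * ?x i) + (\<Sum>i<n. \<Sum>j<n. a i j * (?x i * ?x j))"
      by (rule ba)
    also have "\<dots> = of_bool (q 0 = 1) + (\<Sum>i<n. of_bool (b i = 1 \<and> x i))
        + (\<Sum>i<n. \<Sum>j<n. of_bool (a i j = 1 \<and> x i \<and> x j))"
      by (simp only: mult one)
    also have "\<dots> = of_nat (of_bool (q 0 = 1) + (\<Sum>i<n. of_bool (b i = 1 \<and> x i))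
        + (\<Sum>i<n. \<Sum>j<n. of_bool (a i j = 1 \<and> x i \<and> x j)))"
      by (simp only: of_nat_add of_nat_sum of_nat_of_bool)
    finally show "g x = (- 1) ^ (of_bool (q 0 = 1) + (\<Sum>i<n. of_bool (b i = 1 \<and> x i))
        + (\<Sum>i<n. \<Sum>j<n. of_bool (a i j = 1 \<and> x i \<and> x j)))"
      using g[OF x] by (simp only: minus_one_power_eq_chi)
  qed
qed

definition to_bool :: "(nat \<Rightarrow> bit) \<Rightarrow> nat \<Rightarrow> bool" where
  "to_bool x = (\<lambda>i. x i = 1)"

lemma to_bool_inverse: "(\<lambda>i. of_bool (to_bool x i)) = x" "to_bool (\<lambda>i. of_bool (y i)) = y"
  by (auto simp: to_bool_def fun_eq_iff of_bool_def)

lemma bij_to_bool: "bij_betw to_bool (bcube n) (cube n)"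
  by (rule bij_betw_byWitness[where f' = "\<lambda>y i. of_bool (y i)"])
    (auto simp: to_bool_inverse cube_def bcube_def to_bool_def)

lemma finite_cube: "finite (cube n)"
  using bij_betw_finite[OF bij_to_bool] by simp

lemma vadd_to_bool: "vadd (to_bool x) (to_bool y) = to_bool (x + y)"
proof
  fix i show "vadd (to_bool x) (to_bool y) i = to_bool (x + y) i"
    by (cases "x i"; cases "y i") (simp_all add: vadd_def to_bool_def)
qed

lemma vsum_eq_odd_sum:
  assumes "finite S"
  shows "vsum S z j = odd (\<Sum>i\<in>S. of_bool (z i j) :: nat)"
  using assms by (simp add: vsum_def of_bool_def sum.If_cases Int_def)

lemma prod_Pow_insert:
  assumes "finite A" "a \<notin> A"
  shows "(\<Prod>S\<in>Pow (insert a A). g S) = (\<Prod>S\<in>Pow A. g S) * (\<Prod>S\<in>Pow A. g (insert a S))"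
proof -
  have "inj_on (insert a) (Pow A)" using assms(2) by (auto simp: inj_on_def)
  moreover have "Pow A \<inter> insert a ` Pow A = {}" using assms(2) by auto
  ultimately show ?thesis
    using assms(1) by (simp add: Pow_insert prod.union_disjoint prod.reindex)
qed

lemma sum_PiE_three:
  "(\<Sum>ys\<in>PiE {..<3} (\<lambda>_. A). G (ys 0) (ys 1) (ys (2::nat))) = (\<Sum>a\<in>A. \<Sum>b\<in>A. \<Sum>c\<in>A. G a b c)"
proof -
  \<comment> \<open>The inverse map must return \<open>undefined\<close> beyond index 2, because the
    elements of \<open>PiE\<close> are extensional.\<close>
  have "(\<Sum>ys\<in>PiE {..<3} (\<lambda>_. A). G (ys 0) (ys 1) (ys (2::nat))) = (\<Sum>(a, b, c)\<in>A \<times> A \<times> A. G a b c)"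
    by (rule sum.reindex_bij_witness[of _
        "\<lambda>(a, b, c) i. if i = 0 then a else if i = 1 then b else if i = (2::nat) then c else undefined"
        "\<lambda>ys. (ys 0, ys 1, ys 2)"])
      (auto simp: PiE_iff extensional_def fun_eq_iff numeral_3_eq_3 less_Suc_eq numeral_2_eq_2)
  then show ?thesis by (simp add: sum.cartesian_product')
qed

text \<open>The eight vertices form two copies of the square spanned by \<open>a\<close> and
  \<open>b\<close>, one shifted by \<open>c\<close>. Summed over \<open>x\<close> and
  \<open>c\<close>, the product of the two copies becomes the square of a single box
  correlation.\<close>

lemma gowers_sum_eq_box_corr:
  fixes f :: "(nat \<Rightarrow> bool) \<Rightarrow> real"
  defines "F \<equiv> \<lambda>x. f (to_bool x)"
  shows "(\<Sum>x\<in>cube n. \<Sum>ys\<in>PiE {..<3} (\<lambda>_. cube n). \<Prod>S\<in>Pow {..<3}. f (vadd x (vsum S ys)))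
    = (\<Sum>y\<in>bcube n. \<Sum>h\<in>bcube n. box_corr n F y h ^ 2)"
proof -
  let ?V = "bcube n"
  have to_cube: "(\<Sum>x\<in>cube n. g x) = (\<Sum>x\<in>?V. g (to_bool x))" for g :: "_ \<Rightarrow> real"
    by (rule sum.reindex_bij_betw[OF bij_to_bool, symmetric])
  define G where "G = (\<lambda>x a b c. f x * f (vadd x a) * f (vadd x b) * f (vadd x (vadd a b))
      * (f (vadd x c) * f (vadd x (vadd a c)) * f (vadd x (vadd b c)) * f (vadd x (vadd a (vadd b c)))))"
  have three: "{..<3} = insert 2 (insert 1 (insert 0 ({} :: nat set)))" by auto
  have pt: "(\<Prod>S\<in>Pow {..<3}. f (vadd x (vsum S ys))) = G x (ys 0) (ys 1) (ys 2)" for x ys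
  proof -
    have "vadd x (vsum {} ys) = x" "vsum {0} ys = ys 0" "vsum {1} ys = ys 1" "vsum {2} ys = ys 2"
      "vsum {1, 0} ys = vadd (ys 0) (ys 1)" "vsum {2, 0} ys = vadd (ys 0) (ys 2)"
      "vsum {2, 1} ys = vadd (ys 1) (ys 2)" "vsum {2, 1, 0} ys = vadd (ys 0) (vadd (ys 1) (ys 2))"
      by (auto simp: fun_eq_iff vsum_eq_odd_sum vadd_def simp del: sum_of_bool_eq)
    then show ?thesis
      unfolding three by (simp add: prod_Pow_insert G_def mult_ac del: One_nat_def)
  qed
  have "(\<Sum>x\<in>cube n. \<Sum>ys\<in>PiE {..<3} (\<lambda>_. cube n). \<Prod>S\<in>Pow {..<3}. f (vadd x (vsum S ys)))
      = (\<Sum>x\<in>cube n. \<Sum>a\<in>cube n. \<Sum>b\<in>cube n. \<Sum>c\<in>cube n. G x a b c)"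
    by (simp only: pt sum_PiE_three)
  also have "\<dots> = (\<Sum>x\<in>?V. \<Sum>a\<in>?V. \<Sum>b\<in>?V. \<Sum>c\<in>?V. G (to_bool x) (to_bool a) (to_bool b) (to_bool c))"
    by (simp only: to_cube)
  also have "\<dots> = (\<Sum>a\<in>?V. \<Sum>x\<in>?V. \<Sum>b\<in>?V. \<Sum>c\<in>?V. G (to_bool x) (to_bool a) (to_bool b) (to_bool c))"
    by (rule sum.swap)
  also have "\<dots> = (\<Sum>a\<in>?V. \<Sum>b\<in>?V. \<Sum>x\<in>?V. \<Sum>c\<in>?V. G (to_bool x) (to_bool a) (to_bool b) (to_bool c))"
    by (intro sum.cong refl sum.swap)
  also have "\<dots> = (\<Sum>a\<in>?V. \<Sum>b\<in>?V. box_corr n F a b ^ 2)"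
  proof (intro sum.cong refl)
    fix a b
    define H where "H = (\<lambda>x. F x * F (x + a) * F (x + b) * F (x + a + b))"
    have "(\<Sum>x\<in>?V. \<Sum>c\<in>?V. G (to_bool x) (to_bool a) (to_bool b) (to_bool c))
        = (\<Sum>x\<in>?V. \<Sum>c\<in>?V. H x * H (x + c))"
      by (simp add: G_def H_def F_def vadd_to_bool add_ac mult_ac)
    also have "\<dots> = (\<Sum>x\<in>?V. \<Sum>c\<in>?V. H x * H c)"
      by (intro sum.cong refl sum_translate')
    also have "\<dots> = box_corr n F a b ^ 2"
      by (simp add: power2_eq_square sum_product box_corr_def H_def)
    finally show "(\<Sum>x\<in>?V. \<Sum>c\<in>?V. G (to_bool x) (to_bool a) (to_bool b) (to_bool c)) = box_corr n F a b ^ 2" .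
  qed
  finally show ?thesis .
qed

lemma gowers_norm_3_spectrum:
  fixes f :: "(nat \<Rightarrow> bool) \<Rightarrow> real"
  defines "F \<equiv> \<lambda>x. f (to_bool x)"
  assumes "gowers_norm n 3 f \<ge> \<epsilon>" "\<epsilon> > 0"
  shows "\<epsilon> ^ 8 * 2 ^ n \<le> (\<Sum>p\<in>bcube2 n. dspec n F p ^ 2)"
proof -
  define S where "S = (\<Sum>y\<in>bcube n. \<Sum>h\<in>bcube n. box_corr n F y h ^ 2)"
  have "gowers_norm n 3 f = root 8 (S / (2 ^ n) ^ 4)"
    by (simp add: gowers_norm_def S_def F_def gowers_sum_eq_box_corr)
  then have "\<epsilon> ^ 8 \<le> root 8 (S / (2 ^ n) ^ 4) ^ 8"
    using assms(2,3) by (intro power_mono) auto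
  also have "\<dots> = S / (2 ^ n) ^ 4"
    by (rule real_root_pow_pos2) (auto simp: S_def intro!: sum_nonneg divide_nonneg_nonneg)
  also have "S = (2 ^ n) ^ 3 * (\<Sum>p\<in>bcube2 n. dspec n F p ^ 2)"
    unfolding S_def by (rule sum_dspec_square[symmetric])
  also have "\<dots> / (2 ^ n) ^ 4 = (\<Sum>p\<in>bcube2 n. dspec n F p ^ 2) / 2 ^ n"
    by (simp add: eval_nat_numeral)
  finally show ?thesis by (simp add: field_simps)
qed

lemma cube_dist_eq_correlation:
  assumes "\<And>x. x \<in> cube n \<Longrightarrow> f x \<in> {- 1, 1 :: real}" "\<And>x. x \<in> cube n \<Longrightarrow> g x \<in> {- 1, 1 :: real}"
  shows "cube_dist n f g = 1 / 2 - (\<Sum>x\<in>cube n. f x * g x) / 2 ^ n / 2"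
proof -
  have "(\<Sum>x\<in>cube n. f x * g x) = (\<Sum>x\<in>cube n. 1 - 2 * of_bool (f x \<noteq> g x))"
    using assms by (intro sum.cong) force+
  also have "\<dots> = real (card (cube n)) - 2 * real (card {x \<in> cube n. f x \<noteq> g x})"
    using finite_cube by (simp add: sum_subtractf sum_distrib_left[symmetric] of_bool_def sum.If_cases Int_def)
  also have "real (card (cube n)) = 2 ^ n"
    using bij_betw_same_card[OF bij_to_bool, of n] real_card_bcube[of n] by simp
  finally show ?thesis by (simp add: cube_dist_def field_simps)
qed

theorem theorem2p3:
  shows "\<exists>C c :: real. C > 0 \<and> c > 0 \<and>
    (\<forall>(n::nat) (\<epsilon>::real) (f :: (nat \<Rightarrow> bool) \<Rightarrow> real).
       n \<ge> 1 \<longrightarrow> 0 < \<epsilon> \<longrightarrow> \<epsilon> \<le> 1 \<longrightarrow>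
       (\<forall>x\<in>cube n. f x \<in> {-1, 1}) \<longrightarrow>
       gowers_norm n 3 f \<ge> \<epsilon> \<longrightarrow>
       (\<exists>g \<epsilon>'. quad_poly_fun n g \<and> \<epsilon>' \<ge> c * exp (- ((1 / \<epsilon>) powr C)) \<and>
               cube_dist n f g \<le> 1 / 2 - \<epsilon>'))"
proof -
  obtain D where D: "D \<ge> 0"
      "\<And>u. 0 < u \<Longrightarrow> u \<le> 1 \<Longrightarrow> exp (- D * (1 / u) ^ 144) \<le> corr_bound u / 2"
    using corr_bound_lower by blast
  \<comment> \<open>Here 1152 = 8 * 144, as \<open>corr_bound_lower\<close> is applied at u =
    \<epsilon>^8; the successor comes from \<open>power_le_higher_power_plus\<close>.\<close>
  have main: "\<exists>g \<epsilon>'. quad_poly_fun n g \<and> \<epsilon>' \<ge> exp (- (D ^ Suc 1152)) * exp (- ((1 / \<epsilon>) powr (real (Suc 1152))))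
      \<and> cube_dist n f g \<le> 1 / 2 - \<epsilon>'"
    if \<epsilon>: "0 < \<epsilon>" "\<epsilon> \<le> 1" and f: "\<forall>x\<in>cube n. f x \<in> {-1, 1}" and norm: "gowers_norm n 3 f \<ge> \<epsilon>"
    for n and \<epsilon> :: real and f :: "(nat \<Rightarrow> bool) \<Rightarrow> real"
  proof -
    define F where "F = (\<lambda>x. f (to_bool x))"
    have in_cube: "to_bool x \<in> cube n" if "x \<in> bcube n" for x
      using bij_to_bool that by (auto simp: bij_betw_def)
    have F1: "\<bar>F x\<bar> = 1" if "x \<in> bcube n" for x using f in_cube[OF that] by (auto simp: F_def)
    have e8: "0 < \<epsilon> ^ 8" "\<epsilon> ^ 8 \<le> 1" using \<epsilon> by (simp_all add: power_le_one)
    have "\<epsilon> ^ 8 * 2 ^ n \<le> (\<Sum>p\<in>bcube2 n. dspec n F p ^ 2)"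
      using gowers_norm_3_spectrum[OF norm \<epsilon>(1)] by (simp add: F_def)
    from large_spectrum_quadratic_correlation[OF F1 this e8] obtain q where q: "third_diff_zero n q"
        "corr_bound (\<epsilon> ^ 8) * 2 ^ n \<le> \<bar>\<Sum>x\<in>bcube n. F x * chi (q x)\<bar>" by blast
    \<comment> \<open>Only the absolute value of the correlation is bounded below; adding the
      constant 1 to the polynomial corrects a negative sign.\<close>
    define s :: bit where "s = (if (\<Sum>x\<in>bcube n. F x * chi (q x)) \<ge> 0 then 0 else 1)"
    define g where "g = (\<lambda>x. chi (q (\<lambda>i. of_bool (x i)) + s))"
    have "quad_poly_fun n g"
      by (rule third_diff_zero_quad_poly_fun[where q = "\<lambda>x. q x + s"])
        (intro third_diff_zero_add q third_diff_zero_const, simp add: g_def)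
    moreover have "exp (- (D ^ Suc 1152)) * exp (- ((1 / \<epsilon>) powr (real (Suc 1152)))) \<le> corr_bound (\<epsilon> ^ 8) / 2"
    proof -
      have "exp (- (D ^ Suc 1152)) * exp (- ((1 / \<epsilon>) powr (real (Suc 1152))))
          = exp (- ((1 / \<epsilon>) ^ Suc 1152 + D ^ Suc 1152))"
        using \<epsilon> by (subst powr_realpow) (simp_all only: exp_add[symmetric] zero_less_divide_1_iff, simp add: add.commute)
      also have "\<dots> \<le> exp (- (D * (1 / \<epsilon>) ^ 1152))"
        using power_le_higher_power_plus[OF D(1), of "1 / \<epsilon>" 1152] \<epsilon> by (simp only: exp_le_cancel_iff) simp
      also have "\<dots> = exp (- D * (1 / \<epsilon> ^ 8) ^ 144)" by (simp add: power_divide flip: power_mult)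
      also have "\<dots> \<le> corr_bound (\<epsilon> ^ 8) / 2" by (rule D(2)[OF e8])
      finally show ?thesis .
    qed
    moreover have "cube_dist n f g \<le> 1 / 2 - corr_bound (\<epsilon> ^ 8) / 2"
    proof -
      have "(\<Sum>x\<in>cube n. f x * g x) = (\<Sum>x\<in>bcube n. F x * chi (q x + s))"
        by (subst sum.reindex_bij_betw[OF bij_to_bool, symmetric]) (simp add: F_def g_def to_bool_inverse)
      also have "\<dots> = chi s * (\<Sum>x\<in>bcube n. F x * chi (q x))"
        by (simp add: chi_add sum_distrib_left mult_ac)
      also have "\<dots> = \<bar>\<Sum>x\<in>bcube n. F x * chi (q x)\<bar>" by (simp add: s_def)
      finally have "corr_bound (\<epsilon> ^ 8) \<le> (\<Sum>x\<in>cube n. f x * g x) / 2 ^ n"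
        using q(2) by (simp add: field_simps)
      moreover have "g x \<in> {- 1, 1}" for x by (simp add: g_def chi_def)
      ultimately show ?thesis using cube_dist_eq_correlation[of n f g] f by simp
    qed
    ultimately show ?thesis by blast
  qed
  show ?thesis
    by (rule exI[of _ "real (Suc 1152)"], rule exI[of _ "exp (- (D ^ Suc 1152))"]) (use main in auto)
qed

end
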